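(* Let $\mathbb{F}$ be an arbitrary field, let $A$ be an $m\times n$ ACI-matrix over $\mathbb{F}$, and let $\rho$ be an integer with $0\le\rho\le\min\{m,n\}$. Then $A$ has constant rank $\rho$ if and only if $$A\sim \begin{bmatrix} B & * & * \\ 0 & 0 & * \\ 0 & 0 & C\end{bmatrix}$$ for some ACI-matrices $B$ and $C$ such that: $B$ is square upper triangular with nonzero constant diagonal entries, or $B$ is minimal full rank; $C$ is square upper triangular with nonzero constant diagonal entries, or $C$ is maximal full rank; and the number of rows of $B$ plus the number of columns of $C$ is equal to $\rho$. Here the entries $*$ denote arbitrary blocks (the whole matrix being an ACI-matrix), and some block rows and/or block columns may be void (in particular $B$ or $C$ may be the empty $0\times 0$ matrix, regarded as square upper triangular).
   Context: An ACI-matrix over a field $\mathbb{F}$ is a matrix with entries in a polynomial ring $\mathbb{F}[x_1,\ldots,x_k]$ whose entries are polynomials of degree at most one and such that no indeterminate appears in two different columns. A completion of an ACI-matrix is the matrix over $\mathbb{F}$ obtained by assigning a value in $\mathbb{F}$ to each indeterminate. An ACI-matrix has constant rank $\rho$ if every completion of it has rank $\rho$. An $m\times n$ ACI-matrix of constant rank $\rho$ is full rank if $\rho=\min\{m,n\}$. Two $m\times n$ ACI-matrices $A,B$ are equivalent, written $A\sim B$, if there exist a nonsingular constant matrix $T$ of order $m$ (entries in $\mathbb{F}$) and a permutation matrix $Q$ of order $n$ with $TAQ=B$. An $m\times n$ ACI-matrix of constant rank $\rho$ is minimal full rank if $\rho=m<n$ and, for each $j\in\{1,\ldots,n\}$,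 the $m\times(n-1)$ ACI-matrix obtained by deleting column $j$ is not of constant rank $m$. It is maximal full rank if $\rho=n<m$ and, for each $v\in\mathbb{F}^m$, the $m\times(n+1)$ ACI-matrix $[A\ v]$ is not of constant rank $n+1$. *)

theory Defs
  imports
    "Jordan_Normal_Form.DL_Rank"
    "HOL-Library.Poly_Mapping"
    "HOL-Combinatorics.Permutations"
begin

text \<open>
  Polynomials over \<open>'a\<close> in indeterminates indexed by natural numbers: a monomial is a finitely
  supported exponent function, a polynomial a finitely supported function from monomials to
  coefficients, multiplied by convolution. The ring of polynomials in \<open>k\<close> indeterminates is the
  subring of those whose indeterminates have an index in \<open>{..<k}\<close>.
\<close>

type_synonym 'a mpoly = "(nat \<Rightarrow>\<^sub>0 nat) \<Rightarrow>\<^sub>0 'a"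

definition const_poly :: "'a::zero \<Rightarrow> 'a mpoly" where
  "const_poly c = Poly_Mapping.single 0 c"

definition indets :: "'a::zero mpoly \<Rightarrow> nat set" where
  "indets p = (\<Union>m\<in>Poly_Mapping.keys p. Poly_Mapping.keys m)"

definition monom_degree :: "(nat \<Rightarrow>\<^sub>0 nat) \<Rightarrow> nat" where
  "monom_degree m = (\<Sum>i\<in>Poly_Mapping.keys m. Poly_Mapping.lookup m i)"

text \<open>By convention the zero polynomial has total degree \<open>0\<close>.\<close>

definition total_degree :: "'a::zero mpoly \<Rightarrow> nat" where
  "total_degree p = Max (insert 0 (monom_degree ` Poly_Mapping.keys p))"

definition eval_poly :: "(nat \<Rightarrow> 'a) \<Rightarrow> 'a::comm_semiring_1 mpoly \<Rightarrow> 'a" where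
  "eval_poly f p =
     (\<Sum>m\<in>Poly_Mapping.keys p. Poly_Mapping.lookup p m *
        (\<Prod>i\<in>Poly_Mapping.keys m. f i ^ Poly_Mapping.lookup m i))"

definition aci_mat :: "nat \<Rightarrow> 'a::zero mpoly mat \<Rightarrow> bool" where
  "aci_mat k A \<longleftrightarrow>
     (\<forall>i<dim_row A. \<forall>j<dim_col A. indets (A $$ (i, j)) \<subseteq> {..<k} \<and> total_degree (A $$ (i, j)) \<le> 1) \<and>
     (\<forall>j<dim_col A. \<forall>j'<dim_col A. j \<noteq> j' \<longrightarrow>
        (\<forall>i<dim_row A. \<forall>i'<dim_row A. indets (A $$ (i, j)) \<inter> indets (A $$ (i', j')) = {}))"

definition completion :: "(nat \<Rightarrow> 'a) \<Rightarrow> 'a::comm_semiring_1 mpoly mat \<Rightarrow> 'a mat" where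
  "completion f A = map_mat (eval_poly f) A"

text \<open>
  An assignment gives values to all indeterminates; those not occurring in \<open>A\<close> are irrelevant.
  The first argument of \<^const>\<open>vec_space.rank\<close> is the number of rows.
\<close>

definition constant_rank :: "'a::field mpoly mat \<Rightarrow> nat \<Rightarrow> bool" where
  "constant_rank A \<rho> \<longleftrightarrow> (\<forall>f. vec_space.rank (dim_row A) (completion f A) = \<rho>)"

definition permutation_mat :: "nat \<Rightarrow> 'a::zero_neq_one mat \<Rightarrow> bool" where
  "permutation_mat n Q \<longleftrightarrow>
     (\<exists>\<sigma>. \<sigma> permutes {..<n} \<and> Q = mat n n (\<lambda>(i, j). if i = \<sigma> j then 1 else 0))"

definition aci_equiv :: "'a::field mpoly mat \<Rightarrow> 'a mpoly mat \<Rightarrow> bool" where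
  "aci_equiv A B \<longleftrightarrow>
     (\<exists>T Q. T \<in> carrier_mat (dim_row A) (dim_row A) \<and> invertible_mat T \<and>
        permutation_mat (dim_col A) Q \<and>
        map_mat const_poly T * A * map_mat const_poly Q = B)"

definition delete_col :: "'a mat \<Rightarrow> nat \<Rightarrow> 'a mat" where
  "delete_col A j =
     mat (dim_row A) (dim_col A - 1) (\<lambda>(i, l). A $$ (i, if l < j then l else Suc l))"

definition append_const_col :: "'a::zero mpoly mat \<Rightarrow> 'a vec \<Rightarrow> 'a mpoly mat" where
  "append_const_col A v =
     mat (dim_row A) (dim_col A + 1)
       (\<lambda>(i, l). if l < dim_col A then A $$ (i, l) else const_poly (v $ i))"

definition minimal_full_rank :: "'a::field mpoly mat \<Rightarrow> bool" where
  "minimal_full_rank A \<longleftrightarrow>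
     constant_rank A (dim_row A) \<and> dim_row A < dim_col A \<and>
     (\<forall>j<dim_col A. \<not> constant_rank (delete_col A j) (dim_row A))"

definition maximal_full_rank :: "'a::field mpoly mat \<Rightarrow> bool" where
  "maximal_full_rank A \<longleftrightarrow>
     constant_rank A (dim_col A) \<and> dim_col A < dim_row A \<and>
     (\<forall>v\<in>carrier_vec (dim_row A). \<not> constant_rank (append_const_col A v) (dim_col A + 1))"

text \<open>The empty matrix satisfies the following predicate.\<close>

definition upper_triangular_const_diag :: "'a::zero mpoly mat \<Rightarrow> bool" where
  "upper_triangular_const_diag A \<longleftrightarrow>
     square_mat A \<and> upper_triangular A \<and>
     (\<forall>i<dim_row A. \<exists>c. c \<noteq> 0 \<and> A $$ (i, i) = const_poly c)"

text \<open>
  The block matrix with block rows \<open>B X Y\<close>, \<open>0 0 Z\<close> and \<open>0 0 C\<close>. The sizes of the zero blocks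
  are read off from the others.
\<close>

definition block_form ::
    "'a::zero mat \<Rightarrow> 'a mat \<Rightarrow> 'a mat \<Rightarrow> 'a mat \<Rightarrow> 'a mat \<Rightarrow> 'a mat" where
  "block_form B X Y Z C =
     four_block_mat
       (four_block_mat B X (0\<^sub>m (dim_row Z) (dim_col B)) (0\<^sub>m (dim_row Z) (dim_col X)))
       (Y @\<^sub>r Z)
       (0\<^sub>m (dim_row C) (dim_col B + dim_col X))
       C"

end

theory Submission
  imports Defs "HOL-Library.Function_Algebras"
begin

text \<open>
  Since no indeterminate occurs in two columns, the columns of the completions of \<open>A\<close> range
  independently over affine subspaces \<open>S\<^sub>1, \<dots>, S\<^sub>n\<close> of \<open>F\<^sup>m\<close>. By Rado's theorem, the largest
  rank of a choice of vectors \<open>x\<^sub>j \<in> S\<^sub>j\<close> is the minimum over \<open>J\<close> of the dimension of the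
  span \<open>W\<close> of the \<open>S\<^sub>j\<close> with \<open>j \<in> J\<close> plus the number of the remaining columns.
  If every choice has rank \<open>\<rho>\<close>, then for a minimising \<open>J\<close> every choice spans \<open>W\<close> on
  \<open>J\<close> and is independent modulo \<open>W\<close> off \<open>J\<close>. Choosing a minimal subset of \<open>J\<close> that
  always spans \<open>W\<close> gives \<open>B\<close>, and choosing a maximal subspace \<open>U \<supseteq> W\<close> modulo which the
  remaining columns are always independent gives \<open>C\<close>.

  In the square case, triangularity needs a column that is constant. If some column is not constant,
  replace it by a nonzero direction \<open>v\<close> of its affine subspace. All choices then have rank one less,
  and a minimising \<open>J\<close> as above, with that column removed, yields a smaller square
  nonsingular block, to which induction applies.
\<close>

section \<open>Rado's theorem for families of sets of vectors\<close>

text \<open>The field may be finite, even with two elements, so no generic completion is available.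
  Everything therefore rests on counting dimensions: Rado's theorem is proved for arbitrary nonempty
  sets of vectors, and affinity of these sets is used only to find a constant column.

  A minimising J gives so much because the bound has no slack. The columns in J contribute at most
  \<open>dim W\<close> to the rank and each other column at most one; if every choice reaches this
  total, every choice attains both bounds.

  The alternatives for B and C are also matters of counting. A family that always spans W has at
  least \<open>dim W\<close> members: with equality the block is square, otherwise its minimality is
  the deletion condition. Dually, columns always independent modulo U are at most as many as the
  codimension of U: with equality the block is square, otherwise maximality of U says that no
  constant column can be appended.

  Both the induction in the square case and the block C live in quotients by a subspace. Quotients
  are never formed: statements carry a set U and compare \<open>dim (U \<union> X)\<close> with
  \<open>dim U\<close>.\<close>

locale vector_families = vector_space scale
  for scale :: "'a::field \<Rightarrow> 'b::ab_group_add \<Rightarrow> 'b" (infixr \<open>*s\<close> 75)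
begin

section \<open>Dimension of finitely spanned sets\<close>

text \<open>The ambient space will be the infinite-dimensional space of all functions from the
  naturals to the field, so finiteness is attached to the sets instead of the space.\<close>

definition fin_spanned :: "'b set \<Rightarrow> bool" where
  "fin_spanned X \<longleftrightarrow> (\<exists>E. finite E \<and> X \<subseteq> span E)"

lemma fin_spanned_subset: "fin_spanned Y \<Longrightarrow> X \<subseteq> span Y \<Longrightarrow> fin_spanned X"
  unfolding fin_spanned_def by (meson order_trans span_minimal subspace_span)

lemma fin_spanned_finite: "finite X \<Longrightarrow> fin_spanned X"
  unfolding fin_spanned_def using span_superset by blast

lemma fin_spanned_Un: "fin_spanned X \<Longrightarrow> fin_spanned Y \<Longrightarrow> fin_spanned (X \<union> Y)"
  unfolding fin_spanned_def
proof (elim exE conjE)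
  fix E F assume "finite E" "X \<subseteq> span E" "finite F" "Y \<subseteq> span F"
  then show "\<exists>G. finite G \<and> X \<union> Y \<subseteq> span G"
    by (intro exI[of _ "E \<union> F"]) (meson finite_UnI le_sup_iff order_trans span_mono sup_ge1 sup_ge2)
qed

lemma fin_spanned_insert: "fin_spanned X \<Longrightarrow> fin_spanned (insert x X)"
  using fin_spanned_Un[of X "{x}"] fin_spanned_finite[of "{x}"] by simp

lemma finite_independent:
  assumes "fin_spanned X" "independent B" "B \<subseteq> span X"
  shows "finite B"
  using fin_spanned_subset[OF assms(1,3)] assms(2) independent_span_bound
  unfolding fin_spanned_def by blast

lemma finite_basis:
  assumes "fin_spanned X"
  obtains B where "B \<subseteq> X" "independent B" "finite B" "X \<subseteq> span B" "card B = dim X"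
  by (metis basis_exists finite_independent assms span_superset order_trans)

lemma fin_dim_mono:
  assumes "fin_spanned Y" "X \<subseteq> span Y"
  shows "dim X \<le> dim Y"
proof -
  obtain B where B: "finite B" "Y \<subseteq> span B" "card B = dim Y"
    using finite_basis[OF assms(1)] by metis
  have "X \<subseteq> span B"
    using assms(2) B(2) by (meson order_trans span_minimal subspace_span)
  then show ?thesis using dim_le_card[of X B] B by simp
qed

lemma fin_dim_insert:
  assumes "fin_spanned X"
  shows "dim (insert x X) = (if x \<in> span X then dim X else Suc (dim X))"
proof (cases "x \<in> span X")
  case True
  then show ?thesis by (simp add: span_eq_dim[OF span_redundant])
next
  case False
  obtain B where B: "B \<subseteq> X" "independent B" "finite B" "X \<subseteq> span B" "card B = dim X"
    using finite_basis[OF assms] by metis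
  have "x \<notin> span B" using False B(1) span_mono by blast
  then have "independent (insert x B)" "x \<notin> B"
    using B independent_insertI[of x B] span_base by blast+
  moreover have "insert x X \<subseteq> span (insert x B)"
    using B(4) by (meson insert_subset order_trans span_base insertI1 span_mono subset_insertI)
  ultimately have "dim (insert x X) = card (insert x B)"
    using B(1) by (intro basis_card_eq_dim[symmetric]) auto
  then show ?thesis using False B \<open>x \<notin> B\<close> by simp
qed

lemma fin_dim_spans:
  assumes "fin_spanned Y" "X \<subseteq> span Y" "dim Y \<le> dim X"
  shows "Y \<subseteq> span X"
proof
  fix y assume y: "y \<in> Y"
  show "y \<in> span X"
  proof (rule ccontr)
    assume "y \<notin> span X"
    then have "dim (insert y X) = Suc (dim X)"
      using fin_dim_insert[OF fin_spanned_subset[OF assms(1,2)]] by simp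
    moreover have "dim (insert y X) \<le> dim Y"
      using y assms(2) span_base by (intro fin_dim_mono[OF assms(1)]) auto
    ultimately show False using assms(3) by simp
  qed
qed

lemma fin_dim_Un_card:
  assumes "fin_spanned U" "finite K"
  shows "dim (U \<union> K) \<le> dim U + card K"
  using assms(2)
proof (induction K)
  case (insert y K)
  have "fin_spanned (U \<union> K)"
    using assms(1) insert fin_spanned_Un fin_spanned_finite by blast
  then show ?case using insert fin_dim_insert[of "U \<union> K" y] by auto
qed simp

lemma fin_dim_Un_image:
  assumes "fin_spanned U" "finite K"
  shows "dim (U \<union> x ` K) \<le> dim U + card K"
  using fin_dim_Un_card[OF assms(1), of "x ` K"] assms(2) card_image_le[OF assms(2), of x]
  by fastforce

text \<open>A basis of Z extends to bases of X and of Y, which then share at least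
  \<open>dim Z\<close> vectors. Z is any common subset rather than the intersection of the spans,
  since in the application it consists of the vectors belonging to the common indices.\<close>

lemma fin_dim_submodular:
  assumes "fin_spanned X" "fin_spanned Y" "Z \<subseteq> X" "Z \<subseteq> Y"
  shows "dim (X \<union> Y) + dim Z \<le> dim X + dim Y"
proof -
  have "fin_spanned Z" using assms(1,3) span_superset by (blast intro: fin_spanned_subset)
  then obtain I where I: "I \<subseteq> Z" "independent I" "finite I" "Z \<subseteq> span I" "card I = dim Z"
    using finite_basis by metis
  have ext: "\<exists>B. finite B \<and> I \<subseteq> B \<and> X' \<subseteq> span B \<and> card B = dim X'"
    if X': "fin_spanned X'" "Z \<subseteq> X'" for X'
  proof -
    obtain B where B: "I \<subseteq> B" "B \<subseteq> X'" "independent B" "X' \<subseteq> span B"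
      using maximal_independent_subset_extend[OF subset_trans[OF I(1) X'(2)] I(2)] by metis
    moreover have "finite B"
      by (rule finite_independent[OF X'(1) B(3) subset_trans[OF B(2) span_superset]])
    ultimately show ?thesis using basis_card_eq_dim[of B X'] by (intro exI[of _ B] conjI)
  qed
  obtain B where B: "finite B" "I \<subseteq> B" "X \<subseteq> span B" "card B = dim X"
    using ext[OF assms(1,3)] by blast
  obtain C where C: "finite C" "I \<subseteq> C" "Y \<subseteq> span C" "card C = dim Y"
    using ext[OF assms(2,4)] by blast
  have "X \<union> Y \<subseteq> span (B \<union> C)"
    using B(3) C(3) by (meson Un_least order_trans span_mono sup_ge1 sup_ge2)
  then have "dim (X \<union> Y) \<le> card (B \<union> C)" using dim_le_card B C by simp
  moreover have "card (B \<union> C) + card (B \<inter> C) = card B + card C"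
    using card_Un_Int[OF B(1) C(1)] by simp
  moreover have "card I \<le> card (B \<inter> C)" using B C by (intro card_mono) auto
  ultimately show ?thesis using B C I by simp
qed

section \<open>Rado's theorem with a deficiency, modulo a subspace\<close>

text \<open>If no vector of \<open>S k\<close> could replace the whole set, each of them would lie
  in the span of a tight subfamily without k. Tight subfamilies are closed under union, so a single
  one would span all of \<open>S k\<close>, and adding k to it would violate the condition. The
  number d is the amount by which a transversal may fall short of independence modulo U.\<close>

lemma rado_step:
  assumes N: "finite N" and k: "k \<in> N" "S k \<noteq> {}"
    and fs: "fin_spanned (U \<union> \<Union>(S ` N))"
    and cond: "\<And>J. J \<subseteq> N \<Longrightarrow> card J + dim U \<le> dim (U \<union> \<Union>(S ` J)) + d"
  shows "\<exists>y\<in>S k. \<forall>J\<subseteq>N. card J + dim U \<le> dim (U \<union> \<Union>((S(k := {y})) ` J)) + d"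
proof (rule ccontr)
  assume neg: "\<not> ?thesis"
  define X where "X J = U \<union> \<Union>(S ` J)" for J
  define T where "T = {J. J \<subseteq> N - {k} \<and> dim (X J) + d = card J + dim U}"
  have fsX: "fin_spanned (X J)" if "J \<subseteq> N" for J
    unfolding X_def by (rule fin_spanned_subset[OF fs], rule subset_trans[OF _ span_superset]) (use that in blast)
  have fin: "finite J" if "J \<subseteq> N" for J using that N finite_subset by blast
  \<comment> \<open>A subfamily violating the condition for y must contain k; without k it satisfies
    the condition, so it is tight and adding y does not raise its dimension.\<close>
  have tight: "\<exists>J\<in>T. y \<in> span (X J)" if y: "y \<in> S k" for y
  proof -
    obtain J where J: "J \<subseteq> N" "dim (U \<union> \<Union>((S(k := {y})) ` J)) + d < card J + dim U"
      using neg y by (meson not_le)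
    have "k \<in> J"
    proof (rule ccontr)
      assume "k \<notin> J"
      then have "(S(k := {y})) ` J = S ` J" by auto
      then show False using J cond[of J] by simp
    qed
    define J' where "J' = J - {k}"
    have J': "J' \<subseteq> N - {k}" "J' \<subseteq> N" "card J = Suc (card J')"
      using \<open>k \<in> J\<close> J(1) fin[OF J(1)] unfolding J'_def by (auto simp: card_Suc_Diff1 simp del: card_Diff_insert)
    have "U \<union> \<Union>((S(k := {y})) ` J) = insert y (X J')"
      using \<open>k \<in> J\<close> unfolding J'_def X_def by auto
    then have "dim (insert y (X J')) + d \<le> card J' + dim U" using J J' by simp
    moreover have "card J' + dim U \<le> dim (X J') + d" using cond[OF J'(2)] by (simp add: X_def)
    ultimately have "y \<in> span (X J')" "dim (X J') + d = card J' + dim U"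
      using fin_dim_insert[OF fsX[OF J'(2)], of y] by (auto split: if_splits)
    then show ?thesis using J'(1) unfolding T_def by blast
  qed
  \<comment> \<open>Submodularity bounds the dimensions for union and intersection together from
    above by two equalities, the condition bounds each from below; so both are tight.\<close>
  have union: "J1 \<union> J2 \<in> T" if "J1 \<in> T" "J2 \<in> T" for J1 J2
  proof -
    have sub: "J1 \<subseteq> N" "J2 \<subseteq> N" "J1 \<union> J2 \<subseteq> N" "J1 \<inter> J2 \<subseteq> N" using that unfolding T_def by auto
    have "dim (X J1 \<union> X J2) + dim (X (J1 \<inter> J2)) \<le> dim (X J1) + dim (X J2)"
      by (intro fin_dim_submodular fsX sub) (auto simp: X_def)
    moreover have "X J1 \<union> X J2 = X (J1 \<union> J2)" unfolding X_def by auto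
    moreover have "card (J1 \<union> J2) + card (J1 \<inter> J2) = card J1 + card J2"
      using card_Un_Int[OF fin[OF sub(1)] fin[OF sub(2)]] by simp
    moreover have "card (J1 \<union> J2) + dim U \<le> dim (X (J1 \<union> J2)) + d"
      "card (J1 \<inter> J2) + dim U \<le> dim (X (J1 \<inter> J2)) + d"
      using cond sub unfolding X_def by blast+
    ultimately show ?thesis using that unfolding T_def by auto
  qed
  have "finite T" unfolding T_def by (rule finite_subset[of _ "Pow N"]) (use N in auto)
  moreover obtain y0 where "y0 \<in> S k" using k by blast
  then have "T \<noteq> {}" using tight by blast
  ultimately have "\<Union>T \<in> T"
  proof -
    have "finite F \<Longrightarrow> F \<noteq> {} \<Longrightarrow> F \<subseteq> T \<Longrightarrow> \<Union>F \<in> T" for F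
      by (induction F rule: finite_ne_induct) (use union in auto)
    then show ?thesis using \<open>finite T\<close> \<open>T \<noteq> {}\<close> by blast
  qed
  define J where "J = \<Union>T"
  have J: "J \<subseteq> N - {k}" "dim (X J) + d = card J + dim U"
    using \<open>\<Union>T \<in> T\<close> unfolding T_def J_def by auto
  \<comment> \<open>Hence adding k to the tight J increases the cardinality by one and the dimension
    not at all.\<close>
  have "S k \<subseteq> span (X J)"
  proof
    fix y assume "y \<in> S k"
    then obtain J1 where "J1 \<in> T" "y \<in> span (X J1)" using tight by blast
    moreover have "X J1 \<subseteq> X J" using \<open>J1 \<in> T\<close> unfolding X_def J_def by blast
    ultimately show "y \<in> span (X J)" using span_mono by blast
  qed
  then have "dim (X (insert k J)) \<le> dim (X J)"
    using J span_superset[of "X J"] by (intro fin_dim_mono fsX) (auto simp: X_def)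
  moreover have "card (insert k J) + dim U \<le> dim (X (insert k J)) + d"
    using cond[of "insert k J"] J k unfolding X_def by blast
  moreover have "card (insert k J) = Suc (card J)"
    using J fin[of J] by (subst card_insert_disjoint) auto
  ultimately show False using J by simp
qed

theorem rado:
  assumes N: "finite N" and ne: "\<And>j. j \<in> N \<Longrightarrow> S j \<noteq> {}"
    and fs: "fin_spanned (U \<union> \<Union>(S ` N))"
    and cond: "\<And>J. J \<subseteq> N \<Longrightarrow> card J + dim U \<le> dim (U \<union> \<Union>(S ` J)) + d"
  shows "\<exists>x. (\<forall>j\<in>N. x j \<in> S j) \<and> card N + dim U \<le> dim (U \<union> x ` N) + d"
proof -
  \<comment> \<open>The invariant keeps the condition for all J while the sets indexed by M are
    reduced to single vectors; for \<open>M = N\<close> its instance \<open>J = N\<close> is the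
    conclusion.\<close>
  define P where "P M x \<longleftrightarrow> (\<forall>j\<in>M. x j \<in> S j) \<and>
    (\<forall>J\<subseteq>N. card J + dim U \<le> dim (U \<union> \<Union>((\<lambda>j. if j \<in> M then {x j} else S j) ` J)) + d)" for M x
  have "\<exists>x. P M x" if "finite M" "M \<subseteq> N" for M
    using that
  proof (induction M)
    case empty
    then show ?case using cond unfolding P_def by simp
  next
    case (insert k M)
    then obtain x where x: "P M x" by auto
    let ?S = "\<lambda>j. if j \<in> M then {x j} else S j"
    have "\<exists>y\<in>?S k. \<forall>J\<subseteq>N. card J + dim U \<le> dim (U \<union> \<Union>((?S(k := {y})) ` J)) + d"
    proof (rule rado_step[OF N])
      show "fin_spanned (U \<union> \<Union>(?S ` N))"
        by (rule fin_spanned_subset[OF fs])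
          (use x insert.prems in \<open>auto simp: P_def intro!: span_base split: if_splits\<close>)
    qed (use x insert ne in \<open>auto simp: P_def\<close>)
    then obtain y where y: "y \<in> S k"
      "\<forall>J\<subseteq>N. card J + dim U \<le> dim (U \<union> \<Union>((?S(k := {y})) ` J)) + d"
      using insert by auto
    have "?S(k := {y}) = (\<lambda>j. if j \<in> insert k M then {(x(k := y)) j} else S j)"
      using insert.hyps by (intro ext) auto
    with y(2) have "\<forall>J\<subseteq>N. card J + dim U
        \<le> dim (U \<union> \<Union>((\<lambda>j. if j \<in> insert k M then {(x(k := y)) j} else S j) ` J)) + d"
      by (simp only:)
    moreover have "\<forall>j\<in>insert k M. (x(k := y)) j \<in> S j"
      using x y(1) by (simp add: P_def)
    ultimately have "P (insert k M) (x(k := y))"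
      unfolding P_def by blast
    then show ?case by blast
  qed
  then obtain x where x: "P N x" using N by blast
  have "card N + dim U \<le> dim (U \<union> \<Union>((\<lambda>j. if j \<in> N then {x j} else S j) ` N)) + d"
    using x unfolding P_def by (elim conjE allE[of _ N] impE) (rule subset_refl)
  also have "\<Union>((\<lambda>j. if j \<in> N then {x j} else S j) ` N) = x ` N" by auto
  finally show ?thesis using x unfolding P_def by auto
qed

text \<open>Every J bounds the rank from above. If none attained the common rank r, the condition of
  \<open>rado\<close> would hold with a deficiency one smaller than the actual one, and some
  transversal would have rank above r.\<close>

lemma tight_subfamily:
  assumes N: "finite N" and ne: "\<And>j. j \<in> N \<Longrightarrow> S j \<noteq> {}"
    and fs: "fin_spanned (U \<union> \<Union>(S ` N))"
    and rank: "\<And>x. \<forall>j\<in>N. x j \<in> S j \<Longrightarrow> dim (U \<union> x ` N) = r"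
  obtains J where "J \<subseteq> N" "dim (U \<union> \<Union>(S ` J)) + card (N - J) = r"
proof -
  have "\<forall>j\<in>N. \<exists>y. y \<in> S j" using ne by blast
  then obtain x where x: "\<forall>j\<in>N. x j \<in> S j" by metis
  have fsU: "fin_spanned (U \<union> \<Union>(S ` J))" if "J \<subseteq> N" for J
    by (rule fin_spanned_subset[OF fs], rule subset_trans[OF _ span_superset]) (use that in blast)
  have ge: "r \<le> dim (U \<union> \<Union>(S ` J)) + card (N - J)" if J: "J \<subseteq> N" for J
  proof -
    have "r = dim (U \<union> x ` N)" using rank[OF x] by simp
    also have "\<dots> \<le> dim ((U \<union> \<Union>(S ` J)) \<union> x ` (N - J))"
      by (intro fin_dim_mono fin_spanned_Un fsU J fin_spanned_finite)
        (use x N J in \<open>auto intro!: span_base\<close>)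
    also have "\<dots> \<le> dim (U \<union> \<Union>(S ` J)) + card (N - J)"
      using N by (intro fin_dim_Un_image fsU J) auto
    finally show ?thesis .
  qed
  show thesis
  proof (cases "r \<ge> dim U + card N")
    case True
    then show thesis using ge[of "{}"] that[of "{}"] by auto
  next
    case False
    \<comment> \<open>One less than the actual deficiency \<open>dim U + card N - r\<close>, which
      is positive in this case, so the natural subtraction is exact. A J violating the condition for
      this d has bound at most r.\<close>
    define d where "d = dim U + card N - r - 1"
    have "\<exists>J\<subseteq>N. \<not> card J + dim U \<le> dim (U \<union> \<Union>(S ` J)) + d"
    proof (rule ccontr)
      assume "\<not> ?thesis"
      then obtain z where "\<forall>j\<in>N. z j \<in> S j" "card N + dim U \<le> dim (U \<union> z ` N) + d"
        using rado[OF N ne fs, of d] by blast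
      then show False using rank[of z] False unfolding d_def by simp
    qed
    then obtain J where J: "J \<subseteq> N" "\<not> card J + dim U \<le> dim (U \<union> \<Union>(S ` J)) + d" by blast
    have "card N = card J + card (N - J)"
      using J N by (metis card_Diff_subset card_mono finite_subset le_add_diff_inverse)
    then show thesis using that[OF J(1)] J(2) ge[OF J(1)] False unfolding d_def by simp
  qed
qed

section \<open>Independence modulo a subspace\<close>

text \<open>Stated for indexed families, so that two equal columns count as dependent; as a set of
  vectors they would collapse to one.\<close>

definition indep_over :: "'b set \<Rightarrow> ('i \<Rightarrow> 'b) \<Rightarrow> 'i set \<Rightarrow> bool" where
  "indep_over U x K \<longleftrightarrow> (\<forall>c. (\<Sum>j\<in>K. c j *s x j) \<in> span U \<longrightarrow> (\<forall>j\<in>K. c j = 0))"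

lemma span_Un_image:
  assumes "finite K"
  shows "y \<in> span (U \<union> x ` K) \<longleftrightarrow> (\<exists>c. y - (\<Sum>j\<in>K. c j *s x j) \<in> span U)"
  using assms
proof (induction K arbitrary: y)
  case (insert k K)
  have "y \<in> span (U \<union> x ` insert k K) \<longleftrightarrow> (\<exists>a. y - a *s x k \<in> span (U \<union> x ` K))"
    using span_breakdown_eq[of y "x k" "U \<union> x ` K"] by simp
  also have "\<dots> \<longleftrightarrow> (\<exists>a c. y - a *s x k - (\<Sum>j\<in>K. c j *s x j) \<in> span U)"
    by (simp add: insert.IH)
  also have "\<dots> \<longleftrightarrow> (\<exists>c. y - (\<Sum>j\<in>insert k K. c j *s x j) \<in> span U)" (is "?L \<longleftrightarrow> ?R")
  proof
    assume ?L
    then obtain a c where ac: "y - a *s x k - (\<Sum>j\<in>K. c j *s x j) \<in> span U" by blast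
    have "(\<Sum>j\<in>insert k K. (c(k := a)) j *s x j) = a *s x k + (\<Sum>j\<in>K. c j *s x j)"
      using insert.hyps by simp (intro sum.cong, auto)
    then show ?R using ac by (intro exI[of _ "c(k := a)"]) (simp only: diff_diff_eq)
  next
    assume ?R
    then obtain c where "y - (\<Sum>j\<in>insert k K. c j *s x j) \<in> span U" by blast
    then show ?L using insert by (intro exI[of _ "c k"] exI[of _ c]) (simp add: diff_diff_eq)
  qed
  finally show ?case .
qed simp

lemma indep_over_insert:
  assumes "finite K" "k \<notin> K"
  shows "indep_over U x (insert k K) \<longleftrightarrow> indep_over U x K \<and> x k \<notin> span (U \<union> x ` K)"
proof (intro iffI conjI)
  assume L: "indep_over U x (insert k K)"
  show "indep_over U x K"
    unfolding indep_over_def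
  proof (intro allI impI)
    fix c assume c: "(\<Sum>j\<in>K. c j *s x j) \<in> span U"
    have "(\<Sum>j\<in>insert k K. (c(k := 0)) j *s x j) = (\<Sum>j\<in>K. c j *s x j)"
      using assms by simp (intro sum.cong, auto)
    then have "\<forall>j\<in>insert k K. (c(k := 0)) j = 0" using c L unfolding indep_over_def by metis
    then show "\<forall>j\<in>K. c j = 0" using assms(2) by (metis fun_upd_other insertCI)
  qed
  show "x k \<notin> span (U \<union> x ` K)"
  proof
    assume "x k \<in> span (U \<union> x ` K)"
    then obtain c where c: "x k - (\<Sum>j\<in>K. c j *s x j) \<in> span U"
      using span_Un_image[OF assms(1)] by blast
    define c' where "c' j = (if j = k then 1 else - c j)" for j
    have "(\<Sum>j\<in>K. c' j *s x j) = (\<Sum>j\<in>K. - (c j *s x j))"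
      using assms by (intro sum.cong) (auto simp: c'_def)
    then have "(\<Sum>j\<in>insert k K. c' j *s x j) = x k - (\<Sum>j\<in>K. c j *s x j)"
      using assms by (simp add: c'_def sum_negf)
    then have "c' k = 0" using c L unfolding indep_over_def by (metis insertI1)
    then show False by (simp add: c'_def)
  qed
next
  assume R: "indep_over U x K \<and> x k \<notin> span (U \<union> x ` K)"
  show "indep_over U x (insert k K)"
    unfolding indep_over_def
  proof (intro allI impI)
    fix c assume "(\<Sum>j\<in>insert k K. c j *s x j) \<in> span U"
    then have c: "c k *s x k + (\<Sum>j\<in>K. c j *s x j) \<in> span U" using assms by simp
    have ck: "c k = 0"
    proof (rule ccontr)
      assume nz: "c k \<noteq> 0"
      have "inverse (c k) *s (c k *s x k + (\<Sum>j\<in>K. c j *s x j)) \<in> span U"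
        using c by (rule span_scale)
      also have "inverse (c k) *s (c k *s x k + (\<Sum>j\<in>K. c j *s x j)) =
        x k - (\<Sum>j\<in>K. (- inverse (c k) * c j) *s x j)"
        using nz by (simp add: scale_right_distrib scale_sum_right sum_negf)
      finally have "x k \<in> span (U \<union> x ` K)"
        unfolding span_Un_image[OF assms(1)] by (rule exI[of _ "\<lambda>j. - inverse (c k) * c j"])
      then show False using R by blast
    qed
    then have "\<forall>j\<in>K. c j = 0" using c R unfolding indep_over_def by simp
    then show "\<forall>j\<in>insert k K. c j = 0" using ck by simp
  qed
qed

text \<open>Each vector raises the dimension by at most one, so the full count is reached only if
  every vector lies outside the span of U and those before it.\<close>

lemma indep_over_iff_dim:
  assumes "fin_spanned U" "finite K"
  shows "indep_over U x K \<longleftrightarrow> dim (U \<union> x ` K) = dim U + card K"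
  using assms(2)
proof (induction K)
  case empty
  then show ?case by (simp add: indep_over_def)
next
  case (insert k K)
  have "fin_spanned (U \<union> x ` K)"
    using assms(1) insert.hyps fin_spanned_Un fin_spanned_finite finite_imageI by blast
  then show ?case
    using insert.IH insert.hyps fin_dim_insert[of "U \<union> x ` K" "x k"] indep_over_insert[of K k U x]
      fin_dim_Un_image[OF assms(1) insert(1), of x]
    by (auto split: if_splits)
qed

lemma indep_over_subset:
  assumes "indep_over U x K" "L \<subseteq> K" "finite K"
  shows "indep_over U x L"
proof -
  have "indep_over U x (L \<union> M) \<Longrightarrow> indep_over U x L" if "finite M" "finite L" "L \<inter> M = {}" for M
    using that by (induction M) (auto simp: indep_over_insert)
  from this[of "K - L"] show ?thesis using assms
    by (simp add: Un_absorb1 finite_subset)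
qed

lemma indep_over_cong:
  "span U = span U' \<Longrightarrow> (\<And>j. j \<in> K \<Longrightarrow> x j = y j) \<Longrightarrow> indep_over U x K \<longleftrightarrow> indep_over U' y K"
  unfolding indep_over_def by (simp cong: sum.cong)

section \<open>Families all of whose transversals are bases\<close>

text \<open>Three points are used because over the field with two elements a line has only its two
  points, and closure under lines through two points would say nothing.\<close>

definition affine_closed :: "'b set \<Rightarrow> bool" where
  "affine_closed X \<longleftrightarrow> (\<forall>a\<in>X. \<forall>b\<in>X. \<forall>c\<in>X. \<forall>t. a + t *s (b - c) \<in> X)"

text \<open>The sets form a square nonsingular block modulo U, and some member must be a single
  point modulo U. If \<open>S k\<close> is not, it has a direction v outside the span of U; with
  \<open>S k\<close> replaced by v every transversal loses exactly one dimension. A tight subfamily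
  then contains k, and its other members form a smaller square block over the same U.\<close>

lemma constant_member:
  assumes "finite K" "K \<noteq> {}" "U \<subseteq> span V" "fin_spanned V" "dim V = dim U + card K"
    and "\<And>j. j \<in> K \<Longrightarrow> S j \<noteq> {} \<and> affine_closed (S j) \<and> S j \<subseteq> span V"
    and "\<And>x. \<forall>j\<in>K. x j \<in> S j \<Longrightarrow> indep_over U x K"
  shows "\<exists>j\<in>K. \<forall>y\<in>S j. \<forall>z\<in>S j. y - z \<in> span U"
  using assms
proof (induction K arbitrary: V rule: finite_psubset_induct)
  case (psubset K)
  note fsV = psubset.prems(3) and dimV = psubset.prems(4) and S = psubset.prems(5)
    and ind = psubset.prems(6)
  have fsU: "fin_spanned U" using fin_spanned_subset[OF fsV] psubset.prems(2) by blast
  have dim_ind: "dim (U \<union> x ` L) = dim U + card L" if "\<forall>j\<in>K. x j \<in> S j" "L \<subseteq> K" for x L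
    using indep_over_subset[OF ind[OF that(1)] that(2)] indep_over_iff_dim[OF fsU] psubset(1) that
    by (meson finite_subset)
  have "\<forall>j\<in>K. \<exists>y. y \<in> S j" using S by blast
  then obtain x0 where x0: "\<forall>j\<in>K. x0 j \<in> S j" by metis
  obtain k where k: "k \<in> K" using psubset.prems(1) by blast
  show ?case
  proof (cases "\<forall>y\<in>S k. \<forall>z\<in>S k. y - z \<in> span U")
    case True
    then show ?thesis using k by blast
  next
    case False
    then obtain y z where yz: "y \<in> S k" "z \<in> S k" "y - z \<notin> span U" by blast
    define v where "v = y - z"
    define S' where "S' = S(k := {v})"
    have cardK: "card K = Suc (card (K - {k}))" using k psubset(1) by (metis card_Suc_Diff1)
    have vV: "v \<in> span V" using yz S[OF k] unfolding v_def by (intro span_diff) auto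
    have fs': "fin_spanned (U \<union> \<Union>(S' ` K))"
      by (rule fin_spanned_subset[OF fsV]) (use psubset.prems(2) S vV in \<open>auto simp: S'_def\<close>)
    have rank': "dim (U \<union> x ` K) = dim U + card (K - {k})" if x: "\<forall>j\<in>K. x j \<in> S' j" for x
    proof -
      define H where "H = U \<union> x ` (K - {k})"
      have tr: "\<forall>j\<in>K. (x(k := u)) j \<in> S j" if "u \<in> S k" for u
        using x that by (auto simp: S'_def)
      have img: "(x(k := u)) ` (K - {k}) = x ` (K - {k})" for u by auto
      have dimH: "dim H = dim U + card (K - {k})"
        using dim_ind[OF tr[OF yz(1)], of "K - {k}"] unfolding H_def img by blast
      have "x j \<in> span V" if "j \<in> K - {k}" for j
      proof -
        have "x j \<in> S' j" using x that by blast
        then have "x j \<in> S j" using that unfolding S'_def by simp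
        then show ?thesis using S[of j] that by blast
      qed
      then have HV: "H \<subseteq> span V" using psubset.prems(2) unfolding H_def by blast
      have fsH: "fin_spanned H" by (rule fin_spanned_subset[OF fsV HV])
      have "v \<in> span H"
      proof (rule ccontr)
        \<comment> \<open>H has dimension one less than V, so v would complete it to V. Subtracting
          a suitable multiple of v from y would then give a point of \<open>S k\<close> in the span
          of H, hence a dependent transversal.\<close>
        assume v: "v \<notin> span H"
        have "V \<subseteq> span (insert v H)"
          by (rule fin_dim_spans[OF fsV])
            (use v vV HV dimH dimV cardK fin_dim_insert[OF fsH] in auto)
        then have "y \<in> span (insert v H)"
          using S[OF k] yz(1) span_minimal[OF _ subspace_span] by blast
        then obtain t where t: "y - t *s v \<in> span H" using span_breakdown_eq by blast
        define u where "u = y + (- t) *s (y - z)"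
        have u: "u \<in> S k" using S[OF k] yz unfolding affine_closed_def u_def by blast
        have "indep_over U (x(k := u)) (insert k (K - {k}))"
          using ind[OF tr[OF u]] k by (simp add: insert_absorb del: fun_upd_apply)
        then have "u \<notin> span H"
          using indep_over_insert[of "K - {k}" k U "x(k := u)"] psubset(1) unfolding img H_def by simp
        then show False using t unfolding u_def v_def by simp
      qed
      moreover have "x k = v" "K = insert k (K - {k})" using x k unfolding S'_def by auto
      then have "U \<union> x ` K = insert v H" unfolding H_def by (metis Un_insert_right image_insert)
      ultimately show ?thesis using dimH fin_dim_insert[OF fsH] by simp
    qed
    have "S' j \<noteq> {}" if "j \<in> K" for j using S[OF that] by (simp add: S'_def)
    then obtain J where J: "J \<subseteq> K" "dim (U \<union> \<Union>(S' ` J)) + card (K - J) = dim U + card (K - {k})"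
      using tight_subfamily[OF psubset(1) _ fs' rank'] by blast
    have cardJ: "card K = card J + card (K - J)"
      using J psubset(1) by (metis card_Diff_subset card_mono finite_subset le_add_diff_inverse)
    have finJ: "finite J" using J psubset(1) finite_subset by blast
    have fsJ: "fin_spanned (U \<union> \<Union>(S' ` L))" if "L \<subseteq> K" for L
      by (rule fin_spanned_subset[OF fs'], rule subset_trans[OF _ span_superset]) (use that in blast)
    \<comment> \<open>Without k the sets in J are the original ones, whose transversals raise the
      dimension by \<open>card J\<close>; tightness allows only \<open>card J - 1\<close>.\<close>
    have kJ: "k \<in> J"
    proof (rule ccontr)
      assume "k \<notin> J"
      have "dim (U \<union> x0 ` J) \<le> dim (U \<union> \<Union>(S' ` J))"
        by (rule fin_dim_mono[OF fsJ[OF J(1)]], rule subset_trans[OF _ span_superset])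
          (use x0 J \<open>k \<notin> J\<close> in \<open>auto simp: S'_def\<close>)
      then show False using dim_ind[OF x0 J(1)] J(2) cardJ cardK by simp
    qed
    define J' where "J' = J - {k}"
    have cJ': "card J = Suc (card J')" using kJ finJ unfolding J'_def by (metis card_Suc_Diff1)
    have dimJ: "dim (U \<union> \<Union>(S' ` J)) = dim U + card J'"
      using J(2) cardJ cardK cJ' by simp
    \<comment> \<open>Otherwise v alone would be tight and add no dimension to U, although it lies
      outside the span of U.\<close>
    have "J' \<noteq> {}"
    proof
      assume "J' = {}"
      then have "J = {k}" using kJ unfolding J'_def by blast
      then have "U \<union> \<Union>(S' ` J) = insert v U" unfolding S'_def by auto
      then show False using dimJ \<open>J' = {}\<close> yz(3) fin_dim_insert[OF fsU] unfolding v_def by simp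
    qed
    \<comment> \<open>The role of V passes to the span of the tight subfamily. Its dimension over U
      is \<open>card J'\<close>, because v lies in it but tightness discounts one index; so the
      members indexed by J' are again a square block.\<close>
    have "\<exists>j\<in>J'. \<forall>y\<in>S j. \<forall>z\<in>S j. y - z \<in> span U"
    proof (rule psubset.IH[OF _ \<open>J' \<noteq> {}\<close> _ fsJ[OF J(1)] dimJ])
      show "J' \<subset> K" using J kJ unfolding J'_def by blast
      show "U \<subseteq> span (U \<union> \<Union>(S' ` J))" by (rule subset_trans[OF _ span_superset]) blast
      show "S j \<noteq> {} \<and> affine_closed (S j) \<and> S j \<subseteq> span (U \<union> \<Union>(S' ` J))" if "j \<in> J'" for j
      proof -
        have "S j \<subseteq> U \<union> \<Union>(S' ` J)" using that unfolding J'_def S'_def by auto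
        moreover have "S j \<noteq> {} \<and> affine_closed (S j)" using S[of j] J(1) that unfolding J'_def by blast
        ultimately show ?thesis using span_superset[of "U \<union> \<Union>(S' ` J)"] by (meson subset_trans)
      qed
      show "indep_over U x J'" if "\<forall>j\<in>J'. x j \<in> S j" for x
      proof -
        define x' where "x' j = (if j \<in> J' then x j else x0 j)" for j
        have "\<forall>j\<in>K. x' j \<in> S j" using x0 that unfolding x'_def by auto
        then have "indep_over U x' J'"
          using indep_over_subset[OF ind _ psubset(1)] J(1) unfolding J'_def by blast
        then show ?thesis by (subst indep_over_cong[where y = x' and U' = U]) (auto simp: x'_def)
      qed
    qed
    then show ?thesis using J(1) unfolding J'_def by blast
  qed
qed

text \<open>A constant member modulo U goes first; its vector is then adjoined to U and the
  remaining members form a square block over the larger U. The transversal x can be arbitrary, since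
  each set is a single point modulo U and the vectors preceding it.\<close>

lemma triangular_order:
  assumes "finite K" "U \<subseteq> span V" "fin_spanned V" "dim V = dim U + card K"
    and "\<And>j. j \<in> K \<Longrightarrow> S j \<noteq> {} \<and> affine_closed (S j) \<and> S j \<subseteq> span V"
    and "\<And>x. \<forall>j\<in>K. x j \<in> S j \<Longrightarrow> indep_over U x K"
    and x: "\<forall>j\<in>K. x j \<in> S j"
  shows "\<exists>g. bij_betw g {..<card K} K \<and>
    (\<forall>i<card K. \<forall>y\<in>S (g i). y - x (g i) \<in> span (U \<union> x ` g ` {..<i}))"
  using assms
proof (induction K arbitrary: U rule: finite_psubset_induct)
  case (psubset K)
  note fsV = psubset.prems(2) and dimV = psubset.prems(3) and S = psubset.prems(4)
    and ind = psubset.prems(5) and x = psubset.prems(6)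
  show ?case
  proof (cases "K = {}")
    case True
    then show ?thesis by (auto simp: bij_betw_def)
  next
    case False
    obtain j where j: "j \<in> K" "\<forall>y\<in>S j. \<forall>z\<in>S j. y - z \<in> span U"
      using constant_member[of K U V S, OF psubset(1) False psubset.prems(1-3) S ind] by auto
    have fsU: "fin_spanned U" using fin_spanned_subset[OF fsV] psubset.prems(1) by blast
    define K' where "K' = K - {j}"
    define U' where "U' = insert (x j) U"
    have K: "K = insert j K'" "j \<notin> K'" "finite K'" using j psubset(1) unfolding K'_def by auto
    have cK: "card K = Suc (card K')" using K by simp
    have UV: "U' \<subseteq> span V" using psubset.prems(1) S[OF j(1)] x j(1) unfolding U'_def by auto
    have fsU': "fin_spanned U'" using fin_spanned_subset[OF fsV UV] .
    have xU: "x j \<notin> span U"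
      using indep_over_subset[OF ind[OF x], of "{j}"] indep_over_insert[of "{}" j U x] j psubset(1)
      by simp
    have dimU: "dim U' = Suc (dim U)" using fin_dim_insert[OF fsU] xU unfolding U'_def by simp
    have "\<exists>g. bij_betw g {..<card K'} K' \<and>
      (\<forall>i<card K'. \<forall>y\<in>S (g i). y - x (g i) \<in> span (U' \<union> x ` g ` {..<i}))"
    proof (rule psubset.IH[OF _ UV fsV])
      show "K' \<subset> K" using K by blast
      show "dim V = dim U' + card K'" using dimV dimU cK by simp
      show "indep_over U' z K'" if z: "\<forall>i\<in>K'. z i \<in> S i" for z
      proof -
        have "\<forall>i\<in>K. (z(j := x j)) i \<in> S i" using z x K by auto
        then have "dim (U \<union> (z(j := x j)) ` K) = dim U + card K"
          using ind indep_over_iff_dim[OF fsU psubset(1)] by blast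
        moreover have "U \<union> (z(j := x j)) ` K = U' \<union> z ` K'" using K unfolding U'_def by auto
        ultimately show ?thesis using indep_over_iff_dim[OF fsU' K(3)] dimU cK by simp
      qed
    qed (use S x K in auto)
    then obtain g where g: "bij_betw g {..<card K'} K'"
      "\<And>i y. i < card K' \<Longrightarrow> y \<in> S (g i) \<Longrightarrow> y - x (g i) \<in> span (U' \<union> x ` g ` {..<i})" by blast
    define h where "h i = (case i of 0 \<Rightarrow> j | Suc i \<Rightarrow> g i)" for i
    have img: "h ` {..<Suc i} = insert j (g ` {..<i})" for i
      unfolding lessThan_Suc_eq_insert_0 h_def by (auto simp: image_image)
    have "bij_betw h {..<card K} K"
    proof (rule bij_betw_imageI)
      show "h ` {..<card K} = K" using img[of "card K'"] g(1) K cK by (simp add: bij_betw_def)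
      then show "inj_on h {..<card K}" by (intro eq_card_imp_inj_on) auto
    qed
    moreover have "y - x (h i) \<in> span (U \<union> x ` h ` {..<i})" if "i < card K" "y \<in> S (h i)" for i y
    proof (cases i)
      case 0
      then show ?thesis using j x that unfolding h_def by auto
    next
      case (Suc i')
      have "U \<union> x ` h ` {..<i} = U' \<union> x ` g ` {..<i'}" unfolding Suc img U'_def by auto
      then show ?thesis using g(2)[of i' y] that Suc cK unfolding h_def by simp
    qed
    ultimately show ?thesis by blast
  qed
qed

end

section \<open>Families all of whose transversals have the same rank\<close>

text \<open>Concatenation of finite sequences coded as functions; it assembles the column order and
  the adapted basis from their three pieces.\<close>

definition append_fun :: "nat \<Rightarrow> (nat \<Rightarrow> 'c) \<Rightarrow> (nat \<Rightarrow> 'c) \<Rightarrow> nat \<Rightarrow> 'c" where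
  "append_fun k f g i = (if i < k then f i else g (i - k))"

lemma append_fun_simps [simp]:
  "i < k \<Longrightarrow> append_fun k f g i = f i"
  "append_fun k f g (k + i) = g i"
  by (simp_all add: append_fun_def)

lemma append_fun_image_less: "i \<le> k \<Longrightarrow> append_fun k f g ` {..<i} = f ` {..<i}"
  by (rule image_cong) auto

lemma append_fun_image: "append_fun k f g ` {..<k + i} = f ` {..<k} \<union> g ` {..<i}"
proof -
  have "{..<k + i} = {..<k} \<union> (+) k ` {..<i}"
    using image_add_atLeastLessThan[of k 0 i] by (auto simp: lessThan_atLeast0 ivl_disj_un_two)
  then show ?thesis by (simp add: image_Un image_image append_fun_image_less)
qed

lemma append_fun_bij_betw:
  assumes "bij_betw f {..<k} A" "bij_betw g {..<l} B" "A \<inter> B = {}"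
  shows "bij_betw (append_fun k f g) {..<k + l} (A \<union> B)"
proof (rule bij_betw_imageI)
  show img: "append_fun k f g ` {..<k + l} = A \<union> B"
    using assms by (simp add: append_fun_image bij_betw_def)
  have "finite A" "finite B" "card A = k" "card B = l"
    using assms bij_betw_finite bij_betw_same_card by fastforce+
  then have "card (A \<union> B) = k + l" using assms(3) by (simp add: card_Un_disjoint)
  then show "inj_on (append_fun k f g) {..<k + l}"
    by (intro eq_card_imp_inj_on) (simp_all add: img)
qed

lemma ex_bij_betw_lessThan: "finite A \<Longrightarrow> card A = k \<Longrightarrow> \<exists>g. bij_betw g {..<k} A"
  using ex_bij_betw_nat_finite[of A] by (simp add: atLeast0LessThan)

context vector_families
begin

section \<open>The block form without coordinates\<close>

lemma indep_over_reindex: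
  assumes "fin_spanned U" "finite K" "bij_betw h L K"
  shows "indep_over U (\<lambda>l. x (h l)) L \<longleftrightarrow> indep_over U x K"
proof -
  have "finite L" "card L = card K"
    using assms(2) bij_betw_finite[OF assms(3)] bij_betw_same_card[OF assms(3)] by simp_all
  moreover have "(\<lambda>l. x (h l)) ` L = x ` K"
    using assms(3) by (auto simp: bij_betw_def image_image)
  ultimately show ?thesis using indep_over_iff_dim[OF assms(1)] assms(2) by metis
qed

text \<open>Only spanning is recorded. The pieces will be combined into m vectors spanning a space
  of dimension m, so independence need not be tracked along the way.\<close>

lemma relative_basis:
  assumes "fin_spanned V" "U \<subseteq> span V"
  shows "\<exists>w. w ` {..<dim V - dim U} \<subseteq> span V \<and> V \<subseteq> span (U \<union> w ` {..<dim V - dim U})"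
proof -
  have fsU: "fin_spanned U" by (rule fin_spanned_subset[OF assms])
  obtain B where B: "B \<subseteq> U" "independent B" "finite B" "U \<subseteq> span B" "card B = dim U"
    using finite_basis[OF fsU] by metis
  obtain C where C: "B \<subseteq> C" "C \<subseteq> span V" "independent C" "span V \<subseteq> span C"
    using maximal_independent_subset_extend[OF subset_trans[OF B(1) assms(2)] B(2)] by metis
  have fC: "finite C" by (rule finite_independent[OF assms(1) C(3,2)])
  have "card C = dim V" using basis_card_eq_dim[OF C(2,4,3)] by simp
  then have "card (C - B) = dim V - dim U" using B(3,5) C(1) by (simp add: card_Diff_subset)
  then obtain w where "bij_betw w {..<dim V - dim U} (C - B)"
    using ex_bij_betw_lessThan[of "C - B"] fC by blast
  then have w: "w ` {..<dim V - dim U} = C - B" by (simp add: bij_betw_def)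
  have "C \<subseteq> U \<union> (C - B)" using B(1) by blast
  then have "span C \<subseteq> span (U \<union> (C - B))" by (rule span_mono)
  then have "V \<subseteq> span (U \<union> (C - B))" using C(4) span_superset[of V] by (meson subset_trans)
  then show ?thesis using w C(2) by (intro exI[of _ w]) auto
qed

text \<open>The coordinate-free block form: the basis w is adapted to the flag of W, U and the span
  of V, and its pieces of lengths p, a, r index the block rows; \<open>\<sigma>\<close> lists the
  columns of B, then the other columns lying in W, then those of C. Columns lying in W produce the
  zero blocks, and C consists of the coordinates modulo U.\<close>

theorem constant_rank_structure:
  fixes S :: "nat \<Rightarrow> 'b set" and V :: "'b set" and m n \<rho> :: nat
  defines "tr x \<equiv> \<forall>j<n. x j \<in> S j"
  assumes fsV: "fin_spanned V" and dimV: "dim V = m"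
    and S: "\<And>j. j < n \<Longrightarrow> S j \<noteq> {} \<and> affine_closed (S j) \<and> S j \<subseteq> span V"
    and rank: "\<And>x. tr x \<Longrightarrow> dim (x ` {..<n}) = \<rho>"
  shows "\<exists>p a r q b s \<sigma> w. bij_betw \<sigma> {..<n} {..<n} \<and> n = q + b + s \<and> m = p + a + r \<and>
    \<rho> = p + s \<and> span (w ` {..<m}) = span V \<and>
    (\<forall>l<q + b. S (\<sigma> l) \<subseteq> span (w ` {..<p})) \<and>
    (\<forall>x. tr x \<longrightarrow> w ` {..<p} \<subseteq> span (x ` \<sigma> ` {..<q})) \<and>
    (\<forall>x. tr x \<longrightarrow> indep_over (w ` {..<p + a}) (\<lambda>l. x (\<sigma> (q + b + l))) {..<s}) \<and>
    (q = p \<and> (\<forall>i<p. \<forall>y\<in>S (\<sigma> i). y - w i \<in> span (w ` {..<i})) \<or>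
     p < q \<and> (\<forall>l<q. \<exists>x. tr x \<and> \<not> w ` {..<p} \<subseteq> span (x ` \<sigma> ` ({..<q} - {l})))) \<and>
    (r = s \<and> (\<forall>i<s. \<forall>y\<in>S (\<sigma> (q + b + i)).
        y - w (p + a + i) \<in> span (w ` {..<p + a + i})) \<or>
     s < r \<and> (\<forall>v\<in>span V. v \<notin> span (w ` {..<p + a}) \<longrightarrow>
       (\<exists>x. tr x \<and> \<not> indep_over (insert v (w ` {..<p + a})) (\<lambda>l. x (\<sigma> (q + b + l))) {..<s})))"
proof -
  have fs_sub: "fin_spanned X" if "X \<subseteq> span V" for X
    using fin_spanned_subset[OF fsV that] .
  have trS: "x ` J \<subseteq> span V" if "tr x" "J \<subseteq> {..<n}" for x J
  proof (rule image_subsetI)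
    fix j assume "j \<in> J"
    then have "j < n" using that(2) by auto
    then show "x j \<in> span V" using that(1) S[of j] unfolding tr_def by blast
  qed
  have "S j \<noteq> {}" if "j < n" for j using S[OF that] by simp
  then have "\<forall>j<n. \<exists>y. y \<in> S j" by blast
  then obtain x0 where x0: "tr x0" unfolding tr_def by metis
  have extend: "\<exists>x'. tr x' \<and> (\<forall>j\<in>J. x' j = x j)" if "\<forall>j\<in>J. x j \<in> S j" for J x
    using that x0 unfolding tr_def by (intro exI[of _ "\<lambda>j. if j \<in> J then x j else x0 j"]) auto
  have SV: "\<Union>(S ` J) \<subseteq> span V" if "J \<subseteq> {..<n}" for J
  proof (rule UN_least)
    show "S j \<subseteq> span V" if "j \<in> J" for j using S[of j] that \<open>J \<subseteq> {..<n}\<close> by auto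
  qed
  have "dim ({} \<union> x ` {..<n}) = \<rho>" if "\<forall>j\<in>{..<n}. x j \<in> S j" for x
    using rank[of x] that by (simp add: tr_def)
  then obtain J where J: "J \<subseteq> {..<n}" and tight: "dim (\<Union>(S ` J)) + card ({..<n} - J) = \<rho>"
    using tight_subfamily[of "{..<n}" S "{}" \<rho>] S fs_sub[OF SV[OF subset_refl]]
    by (metis finite_lessThan lessThan_iff sup_bot_left)
  define W where "W = \<Union>(S ` J)"
  define p where "p = dim W"
  define K where "K = {..<n} - J"
  define s where "s = card K"
  have K: "finite K" "K \<subseteq> {..<n}" "finite J" using J finite_subset by (auto simp: K_def)
  have ps: "\<rho> = p + s" using tight by (simp add: p_def s_def K_def W_def)
  have WV: "W \<subseteq> span V" using SV[OF J] by (simp add: W_def)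
  note fsW = fs_sub[OF WV]
  have xW: "x ` J \<subseteq> W" if "tr x" for x using that J unfolding tr_def W_def by fastforce
  have nJK: "{..<n} = J \<union> K" using J by (auto simp: K_def)
  \<comment> \<open>The columns outside J contribute at most s to the rank \<open>p + s\<close>, so
    those in J must contribute all of \<open>dim W\<close>.\<close>
  have Wspan: "W \<subseteq> span (x ` J)" if x: "tr x" for x
  proof (rule fin_dim_spans[OF fsW subset_trans[OF xW[OF x] span_superset]])
    have "\<rho> = dim (x ` J \<union> x ` K)" using rank[OF x] by (simp add: nJK image_Un)
    also have "\<dots> \<le> dim (x ` J) + s"
      unfolding s_def by (rule fin_dim_Un_image) (simp_all add: K fin_spanned_finite)
    finally show "dim W \<le> dim (x ` J)" using ps p_def by simp
  qed
  have Kind: "indep_over W x K" if x: "tr x" for x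
  proof -
    have "\<rho> = dim (x ` {..<n})" using rank[OF x] by simp
    also have "\<dots> \<le> dim (W \<union> x ` K)"
    proof (rule fin_dim_mono)
      show "fin_spanned (W \<union> x ` K)" using fsW K fin_spanned_Un fin_spanned_finite by blast
      show "x ` {..<n} \<subseteq> span (W \<union> x ` K)"
        by (rule subset_trans[OF _ span_superset]) (use xW[OF x] in \<open>auto simp: nJK\<close>)
    qed
    finally have "dim W + card K \<le> dim (W \<union> x ` K)" using ps by (simp add: p_def s_def)
    then show ?thesis
      using indep_over_iff_dim[OF fsW K(1)] fin_dim_Un_image[OF fsW K(1), of x] by (simp add: le_antisym)
  qed
  \<comment> \<open>A minimal member gives the columns of B. It has at least p elements; with
    exactly p of them the block is square, otherwise minimality is the deletion property.\<close>
  define L where "L = {I. I \<subseteq> J \<and> (\<forall>x. tr x \<longrightarrow> W \<subseteq> span (x ` I))}"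
  have "finite L" unfolding L_def by (rule finite_subset[of _ "Pow J"]) (use K in auto)
  moreover have "J \<in> L" using Wspan by (simp add: L_def)
  ultimately obtain JB where "JB \<in> L" and JBmin: "\<And>I. I \<in> L \<Longrightarrow> I \<subseteq> JB \<Longrightarrow> I = JB"
    using finite_has_minimal[of L] by blast
  then have JB: "JB \<subseteq> J" and JBspan: "\<And>x. tr x \<Longrightarrow> W \<subseteq> span (x ` JB)"
    unfolding L_def by auto
  have JBn: "JB \<subseteq> {..<n}" "finite JB" using JB J K(3) finite_subset by blast+
  define q where "q = card JB"
  define b where "b = card (J - JB)"
  have "p \<le> card (x0 ` JB)"
    unfolding p_def by (rule dim_le_card[OF JBspan[OF x0]]) (use JBn in simp)
  then have pq: "p \<le> q" using card_image_le[OF JBn(2), of x0] unfolding q_def by linarith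
  have xJBW: "x ` JB \<subseteq> W" if "tr x" for x using xW[OF that] JB by blast
  have "\<exists>g w. bij_betw g {..<q} JB \<and> span (w ` {..<p}) = span W \<and>
    (q = p \<longrightarrow> (\<forall>i<p. \<forall>y\<in>S (g i). y - w i \<in> span (w ` {..<i})))"
  proof (cases "q = p")
    case True
    \<comment> \<open>Any q = p vectors spanning W are independent, so the transversals on JB are
      bases of W and a triangular order exists.\<close>
    have ind: "indep_over {} x JB" if x: "\<forall>j\<in>JB. x j \<in> S j" for x
    proof -
      obtain x' where x': "tr x'" "\<forall>j\<in>JB. x' j = x j" using extend[OF x] by blast
      have "x' ` JB = x ` JB" using x'(2) by (intro image_cong) auto
      then have "dim W \<le> dim (x ` JB)"
        using fin_dim_mono[OF fin_spanned_finite JBspan[OF x'(1)]] JBn by simp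
      then show ?thesis
        using indep_over_iff_dim[OF fin_spanned_finite[of "{}"] JBn(2)] dim_le_card'[of "x ` JB"]
          fin_dim_Un_image[OF fin_spanned_finite[of "{}"] JBn(2), of x] JBn True
        by (simp add: p_def q_def dim_eq_card_independent[OF independent_empty])
    qed
    have "\<exists>g. bij_betw g {..<card JB} JB \<and>
      (\<forall>i<card JB. \<forall>y\<in>S (g i). y - x0 (g i) \<in> span ({} \<union> x0 ` g ` {..<i}))"
    proof (rule triangular_order[OF JBn(2) empty_subsetI fsW _ _ ind])
      show "dim W = dim {} + card JB"
        using True by (simp add: p_def q_def dim_eq_card_independent[OF independent_empty])
      show "S j \<noteq> {} \<and> affine_closed (S j) \<and> S j \<subseteq> span W" if "j \<in> JB" for j
        using that JBn JB S[of j] span_superset[of W] unfolding W_def by blast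
      show "\<forall>j\<in>JB. x0 j \<in> S j" using x0 JBn unfolding tr_def by auto
    qed
    then obtain g where g: "bij_betw g {..<q} JB"
      "\<forall>i<q. \<forall>y\<in>S (g i). y - x0 (g i) \<in> span (x0 ` g ` {..<i})"
      unfolding q_def by auto
    have "span (x0 ` JB) = span W"
      using JBspan[OF x0] subset_trans[OF xJBW[OF x0] span_superset] by (simp add: span_eq)
    then show ?thesis
      using g True by (intro exI[of _ g] exI[of _ "\<lambda>i. x0 (g i)"]) (simp add: bij_betw_def image_image[symmetric])
  next
    case False
    obtain g where "bij_betw g {..<q} JB" using ex_bij_betw_lessThan[OF JBn(2)] q_def by blast
    moreover obtain w where w: "w ` {..<p} \<subseteq> span W" "W \<subseteq> span ({} \<union> w ` {..<p})"
      using relative_basis[OF fsW, of "{}"] by (auto simp: p_def dim_eq_card_independent[OF independent_empty])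
    then have "span (w ` {..<p}) = span W" by (simp add: span_eq)
    ultimately show ?thesis using False by blast
  qed
  then obtain gB wB where gB: "bij_betw gB {..<q} JB" and wB: "span (wB ` {..<p}) = span W"
    and triB: "q = p \<Longrightarrow> \<forall>i<p. \<forall>y\<in>S (gB i). y - wB i \<in> span (wB ` {..<i})" by blast
  obtain gX where gX: "bij_betw gX {..<b} (J - JB)"
    using ex_bij_betw_lessThan[of "J - JB" b] K(3) by (auto simp: b_def)
  \<comment> \<open>U is chosen with the largest possible dimension, so that no vector outside its
    span can be adjoined; W itself qualifies, and m bounds all dimensions.\<close>
  define P where "P d \<longleftrightarrow> (\<exists>U. W \<subseteq> U \<and> U \<subseteq> span V \<and> (\<forall>x. tr x \<longrightarrow> indep_over U x K) \<and> dim U = d)" for d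
  have "P p" using WV Kind unfolding P_def p_def by blast
  moreover have "\<forall>d. P d \<longrightarrow> d \<le> m"
    unfolding P_def using fin_dim_mono[OF fsV] dimV by blast
  ultimately have "P (Greatest P)" and Pmax: "\<And>d. P d \<Longrightarrow> d \<le> Greatest P"
    using GreatestI_nat[of P p m] Greatest_le_nat[of P _ m] by blast+
  then obtain U where U: "W \<subseteq> U" "U \<subseteq> span V" and Uind: "\<And>x. tr x \<Longrightarrow> indep_over U x K"
    and dimU: "dim U = Greatest P"
    unfolding P_def by blast
  note fsU = fs_sub[OF U(2)]
  define a where "a = dim U - p"
  define r where "r = m - dim U"
  have pU: "p \<le> dim U" unfolding p_def
    by (rule fin_dim_mono[OF fsU]) (use U(1) span_superset in blast)
  have UK: "dim U + s \<le> m"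
  proof -
    have "dim (U \<union> x0 ` K) \<le> dim V"
      by (rule fin_dim_mono[OF fsV]) (use U(2) trS[OF x0 K(2)] in blast)
    then show ?thesis using indep_over_iff_dim[OF fsU K(1)] Uind[OF x0] dimV by (simp add: s_def)
  qed
  have mpar: "m = p + a + r" "s \<le> r" "p + a = dim U" using pU UK by (auto simp: a_def r_def)
  obtain wX where wX: "wX ` {..<a} \<subseteq> span U" "U \<subseteq> span (W \<union> wX ` {..<a})"
    using relative_basis[OF fsU, of W] subset_trans[OF U(1) span_superset] by (auto simp: a_def p_def)
  have "\<exists>g w. bij_betw g {..<s} K \<and> w ` {..<r} \<subseteq> span V \<and> V \<subseteq> span (U \<union> w ` {..<r}) \<and>
    (r = s \<longrightarrow> (\<forall>i<s. \<forall>y\<in>S (g i). y - w i \<in> span (U \<union> w ` {..<i})))"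
  proof (cases "r = s")
    case True
    have ind: "indep_over U x K" if x: "\<forall>j\<in>K. x j \<in> S j" for x
    proof -
      obtain x' where x': "tr x'" "\<forall>j\<in>K. x' j = x j" using extend[OF x] by blast
      then show ?thesis
        using Uind[OF x'(1)] indep_over_cong[of U U K x' x] by blast
    qed
    have dimVU: "dim V = dim U + card K" using True mpar dimV by (simp add: s_def)
    have "\<exists>g. bij_betw g {..<card K} K \<and>
      (\<forall>i<card K. \<forall>y\<in>S (g i). y - x0 (g i) \<in> span (U \<union> x0 ` g ` {..<i}))"
    proof (rule triangular_order[OF K(1) U(2) fsV dimVU _ ind])
      show "S j \<noteq> {} \<and> affine_closed (S j) \<and> S j \<subseteq> span V" if "j \<in> K" for j
        using that K S[of j] by blast
      show "\<forall>j\<in>K. x0 j \<in> S j" using x0 K unfolding tr_def by auto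
    qed
    then obtain g where g: "bij_betw g {..<s} K"
      "\<forall>i<s. \<forall>y\<in>S (g i). y - x0 (g i) \<in> span (U \<union> x0 ` g ` {..<i})"
      unfolding s_def by auto
    have UKV: "U \<union> x0 ` K \<subseteq> span V" using U(2) trS[OF x0 K(2)] by blast
    have "V \<subseteq> span (U \<union> x0 ` K)"
      by (rule fin_dim_spans[OF fsV UKV])
        (use dimVU indep_over_iff_dim[OF fsU K(1)] Uind[OF x0] in simp)
    then show ?thesis
      using g UKV True
      by (intro exI[of _ g] exI[of _ "\<lambda>i. x0 (g i)"]) (simp add: bij_betw_def image_image[symmetric])
  next
    case False
    obtain g where "bij_betw g {..<s} K" using ex_bij_betw_lessThan[OF K(1)] s_def by blast
    moreover obtain w where "w ` {..<r} \<subseteq> span V" "V \<subseteq> span (U \<union> w ` {..<r})"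
      using relative_basis[OF fsV U(2)] by (auto simp: r_def dimV)
    ultimately show ?thesis using False by blast
  qed
  then obtain gC wC where gC: "bij_betw gC {..<s} K" and wC: "wC ` {..<r} \<subseteq> span V"
      "V \<subseteq> span (U \<union> wC ` {..<r})"
    and triC: "r = s \<Longrightarrow> \<forall>i<s. \<forall>y\<in>S (gC i). y - wC i \<in> span (U \<union> wC ` {..<i})" by blast
  \<comment> \<open>In the square cases \<open>wB\<close> and \<open>wC\<close> are the vectors of
    the transversal \<open>x0\<close> in triangular order; this is why the differences
    \<open>y - w i\<close> lie in the span of the earlier basis vectors.\<close>
  define w where "w = append_fun (p + a) (append_fun p wB wX) wC"
  define \<sigma> where "\<sigma> = append_fun (q + b) (append_fun q gB gX) gC"
  have wp: "w ` {..<i} = wB ` {..<i}" if "i \<le> p" for i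
    unfolding w_def using that by (simp add: append_fun_image_less)
  have wpa: "w ` {..<p + a} = wB ` {..<p} \<union> wX ` {..<a}"
    unfolding w_def by (simp add: append_fun_image_less append_fun_image)
  have spanWU: "span (w ` {..<p + a}) = span U"
  proof (subst span_eq, intro conjI)
    have "wB ` {..<p} \<subseteq> span W" using span_superset[of "wB ` {..<p}"] unfolding wB .
    then have "wB ` {..<p} \<subseteq> span U" using span_mono[OF U(1)] by (rule subset_trans)
    then show "w ` {..<p + a} \<subseteq> span U" unfolding wpa using wX(1) by blast
    have "W \<subseteq> span (wB ` {..<p})" unfolding wB by (rule span_superset)
    also have "\<dots> \<subseteq> span (w ` {..<p + a})" unfolding wpa by (rule span_mono) blast
    finally have "W \<union> wX ` {..<a} \<subseteq> span (w ` {..<p + a})"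
      using span_superset[of "w ` {..<p + a}"] unfolding wpa by blast
    then have "span (W \<union> wX ` {..<a}) \<subseteq> span (w ` {..<p + a})" by (rule span_minimal) simp
    then show "U \<subseteq> span (w ` {..<p + a})" using wX(2) by blast
  qed
  have spanUC: "span (w ` {..<p + a + i}) = span (U \<union> wC ` {..<i})" for i
  proof -
    have "w ` {..<p + a + i} = w ` {..<p + a} \<union> wC ` {..<i}"
      unfolding wpa by (simp add: w_def append_fun_image)
    then show ?thesis using spanWU by (simp add: span_Un)
  qed
  have spanV: "span (w ` {..<m}) = span V"
    unfolding mpar(1) spanUC span_eq using wC(1) wC(2) U(2) by (metis Un_least)
  have "J \<inter> K = {}" "JB \<inter> (J - JB) = {}" "JB \<union> (J - JB) = J" using JB K_def by auto
  then have bijJ: "bij_betw (append_fun q gB gX) {..<q + b} J"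
    using append_fun_bij_betw[OF gB gX] by simp
  have npar: "n = q + b + s"
    using bij_betw_same_card[OF bijJ] K \<open>J \<inter> K = {}\<close> card_Un_disjoint[of J K] nJK
    by (metis card_lessThan s_def)
  have bij: "bij_betw \<sigma> {..<n} {..<n}"
    using append_fun_bij_betw[OF bijJ gC \<open>J \<inter> K = {}\<close>] by (simp add: npar[symmetric] \<sigma>_def nJK[symmetric])
  have \<sigma>q: "\<sigma> l = gB l" if "l < q" for l using that by (simp add: \<sigma>_def)
  have \<sigma>C: "\<sigma> (q + b + l) = gC l" for l by (simp add: \<sigma>_def)
  have \<sigma>img: "\<sigma> ` {..<q} = JB"
    using gB \<sigma>q unfolding bij_betw_def by (metis image_cong lessThan_iff)
  have wpW: "w ` {..<p} \<subseteq> span X \<longleftrightarrow> W \<subseteq> span X" for X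
    using wB wp[OF order_refl] by (metis span_minimal subspace_span span_superset subset_trans)
  have indK: "indep_over U' (\<lambda>l. x (\<sigma> (q + b + l))) {..<s} \<longleftrightarrow> indep_over U' x K"
    if "fin_spanned U'" for U' x
    unfolding \<sigma>C using indep_over_reindex[OF that K(1) gC] .
  have fsw: "fin_spanned (w ` {..<p + a})" by (rule fin_spanned_finite) simp
  show ?thesis
  proof (intro exI conjI)
    show "bij_betw \<sigma> {..<n} {..<n}" by (rule bij)
    show "n = q + b + s" by (rule npar)
    show "m = p + a + r" by (rule mpar)
    show "\<rho> = p + s" by (rule ps)
    show "span (w ` {..<m}) = span V" by (rule spanV)
    show "\<forall>l<q + b. S (\<sigma> l) \<subseteq> span (w ` {..<p})"
    proof (intro allI impI)
      fix l assume l: "l < q + b"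
      then have "\<sigma> l \<in> J" using bijJ unfolding \<sigma>_def bij_betw_def by auto
      then have "S (\<sigma> l) \<subseteq> W" unfolding W_def by blast
      then show "S (\<sigma> l) \<subseteq> span (w ` {..<p})"
        using wB wp[OF order_refl] span_superset[of W] by auto
    qed
    show "\<forall>x. tr x \<longrightarrow> w ` {..<p} \<subseteq> span (x ` \<sigma> ` {..<q})"
      using JBspan unfolding \<sigma>img wpW by blast
    show "\<forall>x. tr x \<longrightarrow> indep_over (w ` {..<p + a}) (\<lambda>l. x (\<sigma> (q + b + l))) {..<s}"
      unfolding indep_over_cong[OF spanWU refl] indK[OF fsU] using Uind by simp
    show "q = p \<and> (\<forall>i<p. \<forall>y\<in>S (\<sigma> i). y - w i \<in> span (w ` {..<i})) \<or>
     p < q \<and> (\<forall>l<q. \<exists>x. tr x \<and> \<not> w ` {..<p} \<subseteq> span (x ` \<sigma> ` ({..<q} - {l})))"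
    proof (cases "q = p")
      case True
      have "w i = wB i" if "i < p" for i using that by (simp add: w_def)
      then show ?thesis using triB[OF True] True by (auto simp: \<sigma>q wp)
    next
      case False
      have "\<exists>x. tr x \<and> \<not> W \<subseteq> span (x ` \<sigma> ` ({..<q} - {l}))" if l: "l < q" for l
      proof (rule ccontr)
        assume neg: "\<not> ?thesis"
        have "\<sigma> ` ({..<q} - {l}) \<subseteq> JB" using \<sigma>img by blast
        then have "\<sigma> ` ({..<q} - {l}) \<in> L" using neg JB unfolding L_def by blast
        then have "\<sigma> ` ({..<q} - {l}) = \<sigma> ` {..<q}"
          using JBmin \<open>\<sigma> ` ({..<q} - {l}) \<subseteq> JB\<close> \<sigma>img by blast
        moreover have "inj_on \<sigma> {..<q}"
          using bij npar by (auto simp: bij_betw_def intro: inj_on_subset)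
        ultimately show False using l by (auto simp: inj_on_def)
      qed
      then show ?thesis using False pq unfolding wpW by auto
    qed
    show "r = s \<and> (\<forall>i<s. \<forall>y\<in>S (\<sigma> (q + b + i)). y - w (p + a + i) \<in> span (w ` {..<p + a + i})) \<or>
     s < r \<and> (\<forall>v\<in>span V. v \<notin> span (w ` {..<p + a}) \<longrightarrow>
       (\<exists>x. tr x \<and> \<not> indep_over (insert v (w ` {..<p + a})) (\<lambda>l. x (\<sigma> (q + b + l))) {..<s}))"
    proof (cases "r = s")
      case True
      have "w (p + a + i) = wC i" for i by (simp add: w_def)
      then show ?thesis using triC[OF True] True unfolding \<sigma>C spanUC by simp
    next
      case False
      have "\<exists>x. tr x \<and> \<not> indep_over (insert v U) x K" if v: "v \<in> span V" "v \<notin> span U" for v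
      proof (rule ccontr)
        assume "\<not> ?thesis"
        then have "P (Suc (dim U))"
          unfolding P_def using v U fin_dim_insert[OF fsU, of v]
          by (intro exI[of _ "insert v U"]) auto
        then show False using Pmax dimU by fastforce
      qed
      moreover have "span (insert v (w ` {..<p + a})) = span (insert v U)" for v
        using spanWU by (simp add: span_insert)
      then have "indep_over (insert v (w ` {..<p + a})) x K \<longleftrightarrow> indep_over (insert v U) x K" for v x
        by (rule indep_over_cong) simp
      ultimately show ?thesis
        using False mpar(2) unfolding spanWU indK[OF fin_spanned_insert[OF fsw]] by simp
    qed
  qed
qed

end

section \<open>Ranks of matrices\<close>

definition fscale :: "'a::field \<Rightarrow> (nat \<Rightarrow> 'a) \<Rightarrow> nat \<Rightarrow> 'a" where
  "fscale c f = (\<lambda>i. c * f i)"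

lemma fscale_apply [simp]: "fscale c f i = c * f i"
  by (simp add: fscale_def)

interpretation fun_vs: vector_families "fscale :: 'a::field \<Rightarrow> _"
  by unfold_locales (auto simp: fun_eq_iff algebra_simps)

lemma sum_fun_apply [simp]: "(\<Sum>x\<in>A. f x) i = (\<Sum>x\<in>A. f x i)" for f :: "_ \<Rightarrow> _ \<Rightarrow> 'a::comm_monoid_add"
  by (induction A rule: infinite_finite_induct) simp_all

text \<open>Padding by zeros places columns of every height in one type, so that A, its blocks and
  its quotients all use the same notions of span and dimension.\<close>

definition vec_fun :: "'a::zero vec \<Rightarrow> nat \<Rightarrow> 'a" where
  "vec_fun v i = (if i < dim_vec v then v $ i else 0)"

definition col_fun :: "'a::zero mat \<Rightarrow> nat \<Rightarrow> nat \<Rightarrow> 'a" where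
  "col_fun M j i = (if i < dim_row M then M $$ (i, j) else 0)"

lemma vec_fun_inj_on: "inj_on vec_fun (carrier_vec n)"
proof (rule inj_onI)
  fix v w :: "'a vec" assume vw: "v \<in> carrier_vec n" "w \<in> carrier_vec n" "vec_fun v = vec_fun w"
  show "v = w"
  proof (rule eq_vecI)
    fix i assume "i < dim_vec w"
    moreover have "vec_fun v i = vec_fun w i" using vw(3) by simp
    ultimately show "v $ i = w $ i" using vw(1,2) by (simp add: vec_fun_def)
  qed (use vw in auto)
qed

lemma vec_fun_col: "j < dim_col M \<Longrightarrow> vec_fun (col M j) = col_fun M j"
  by (auto simp: vec_fun_def col_fun_def)

lemma (in vec_space) lin_dep_vec_fun:
  assumes A: "finite A" "A \<subseteq> carrier_vec n"
  shows "lin_dep A \<longleftrightarrow> fun_vs.dependent (vec_fun ` A)"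
proof -
  have inj: "inj_on vec_fun A" using inj_on_subset[OF vec_fun_inj_on A(2)] .
  have lc: "lincomb a A = 0\<^sub>v n \<longleftrightarrow> (\<Sum>x\<in>A. fscale (a x) (vec_fun x)) = 0" for a
  proof -
    have dimA: "dim_vec x = n" if "x \<in> A" for x using A(2) that by auto
    have "lincomb a A = 0\<^sub>v n \<longleftrightarrow> (\<forall>i<n. (\<Sum>x\<in>A. a x * x $ i) = 0)"
      using lincomb_dim[OF A] lincomb_index[OF _ A(2)] by (auto simp: vec_eq_iff)
    also have "\<dots> \<longleftrightarrow> (\<forall>i. (\<Sum>x\<in>A. a x * vec_fun x i) = 0)"
    proof -
      have "(\<Sum>x\<in>A. a x * vec_fun x i) = (if i < n then \<Sum>x\<in>A. a x * x $ i else 0)" for i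
        by (auto simp: vec_fun_def dimA intro!: sum.cong sum.neutral)
      then show ?thesis by simp
    qed
    also have "\<dots> \<longleftrightarrow> (\<Sum>x\<in>A. fscale (a x) (vec_fun x)) = 0"
      by (simp add: fun_eq_iff)
    finally show ?thesis .
  qed
  have "lin_dep A \<longleftrightarrow> (\<exists>a. (\<exists>v\<in>A. a v \<noteq> 0) \<and> lincomb a A = 0\<^sub>v n)"
  proof
    assume "lin_dep A"
    then show "\<exists>a. (\<exists>v\<in>A. a v \<noteq> 0) \<and> lincomb a A = 0\<^sub>v n"
      using finite_lin_dep[OF A(1) _ A(2)] by blast
  next
    assume "\<exists>a. (\<exists>v\<in>A. a v \<noteq> 0) \<and> lincomb a A = 0\<^sub>v n"
    then obtain a v where "lincomb a A = 0\<^sub>v n" "v \<in> A" "a v \<noteq> 0" by blast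
    then show "lin_dep A" using A(1) unfolding lin_dep_def by (intro exI[of _ A] exI[of _ a] exI[of _ v]) simp
  qed
  also have "\<dots> \<longleftrightarrow> (\<exists>u. (\<exists>v\<in>A. u (vec_fun v) \<noteq> 0) \<and>
      (\<Sum>x\<in>A. fscale (u (vec_fun x)) (vec_fun x)) = 0)"
  proof
    assume "\<exists>a. (\<exists>v\<in>A. a v \<noteq> 0) \<and> lincomb a A = 0\<^sub>v n"
    then obtain a where a: "\<exists>v\<in>A. a v \<noteq> 0" "(\<Sum>x\<in>A. fscale (a x) (vec_fun x)) = 0"
      using lc by blast
    have "a (inv_into A vec_fun (vec_fun x)) = a x" if "x \<in> A" for x
      using inv_into_f_f[OF inj that] by simp
    then show "\<exists>u. (\<exists>v\<in>A. u (vec_fun v) \<noteq> 0) \<and> (\<Sum>x\<in>A. fscale (u (vec_fun x)) (vec_fun x)) = 0"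
      using a by (intro exI[of _ "\<lambda>y. a (inv_into A vec_fun y)"]) (auto cong: sum.cong)
  next
    assume "\<exists>u. (\<exists>v\<in>A. u (vec_fun v) \<noteq> 0) \<and> (\<Sum>x\<in>A. fscale (u (vec_fun x)) (vec_fun x)) = 0"
    then obtain u where "\<exists>v\<in>A. u (vec_fun v) \<noteq> 0" "(\<Sum>x\<in>A. fscale (u (vec_fun x)) (vec_fun x)) = 0"
      by blast
    then show "\<exists>a. (\<exists>v\<in>A. a v \<noteq> 0) \<and> lincomb a A = 0\<^sub>v n"
      using lc[of "\<lambda>x. u (vec_fun x)"] by (intro exI[of _ "\<lambda>x. u (vec_fun x)"]) simp
  qed
  also have "\<dots> \<longleftrightarrow> fun_vs.dependent (vec_fun ` A)"
    using A(1) by (simp add: fun_vs.dependent_finite sum.reindex[OF inj])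
  finally show ?thesis .
qed

text \<open>Both sides count a maximal independent set of columns: one is taken among the padded
  functions, pulled back, and shown to be maximal among the matrix columns.\<close>

lemma rank_eq_dim_col_fun:
  assumes M: "M \<in> carrier_mat m n"
  shows "vec_space.rank m M = fun_vs.dim (col_fun M ` {..<n})"
proof -
  interpret V: vec_space "TYPE('a)" m .
  define Y where "Y = set (cols M)"
  have Y: "finite Y" "Y \<subseteq> carrier_vec m" using cols_dim[of M] carrier_matD(1)[OF M] by (auto simp: Y_def)
  have img: "vec_fun ` Y = col_fun M ` {..<n}"
    using M vec_fun_col[of _ M] by (auto simp: Y_def cols_def image_image atLeast0LessThan)
  obtain I where I: "I \<subseteq> vec_fun ` Y" "fun_vs.independent I" "vec_fun ` Y \<subseteq> fun_vs.span I"
    using fun_vs.maximal_independent_subset by blast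
  obtain X where X: "X \<subseteq> Y" "I = vec_fun ` X" using I(1) by (meson subset_imageE)
  have finX: "finite X" "X \<subseteq> carrier_vec m" using X Y finite_subset by auto
  have "maximal X (\<lambda>T. T \<subseteq> set (cols M) \<and> V.lin_indpt T)"
    unfolding maximal_def
  proof (intro conjI allI impI)
    show "X \<subseteq> set (cols M)" using X Y_def by simp
    show "\<not> V.lin_dep X" using V.lin_dep_vec_fun[OF finX] I(2) X(2) by simp
    fix T assume T: "X \<subseteq> T \<and> T \<subseteq> set (cols M) \<and> V.lin_indpt T"
    then have T': "T \<subseteq> Y" "finite T" "T \<subseteq> carrier_vec m" using Y finite_subset by (auto simp: Y_def)
    have indT: "fun_vs.independent (vec_fun ` T)" using V.lin_dep_vec_fun[OF T'(2,3)] T by simp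
    show "T = X"
    proof (rule ccontr)
      assume "T \<noteq> X"
      then obtain t where t: "t \<in> T" "t \<notin> X" using T by blast
      have "vec_fun t \<in> fun_vs.span (vec_fun ` X)" using I(3) X(2) T' t by blast
      moreover have "vec_fun ` X \<subseteq> vec_fun ` T - {vec_fun t}"
        using T t inj_on_subset[OF vec_fun_inj_on T'(3)] by (auto simp: inj_on_def)
      ultimately have "vec_fun t \<in> fun_vs.span (vec_fun ` T - {vec_fun t})"
        using fun_vs.span_mono by blast
      then show False using indT t(1) unfolding fun_vs.dependent_def by blast
    qed
  qed
  then have "V.rank M = card X" using V.rank_card_indpt[OF M] by blast
  also have "\<dots> = card I"
    using X(2) inj_on_subset[OF vec_fun_inj_on finX(2)] by (simp add: card_image)
  also have "\<dots> = fun_vs.dim (vec_fun ` Y)" by (rule fun_vs.basis_card_eq_dim[OF I(1,3,2)])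
  finally show ?thesis using img by simp
qed

context vector_families
begin

lemma dim_injective_image:
  assumes "Vector_Spaces.linear scale scale' F" "inj_on F (span X)"
  shows "vector_space.dim scale' (F ` X) = dim X"
proof -
  interpret F: Vector_Spaces.linear scale scale' F by fact
  interpret P: vector_space_pair scale scale' ..
  obtain B where B: "B \<subseteq> X" "independent B" "X \<subseteq> span B" "card B = dim X"
    using basis_exists by metis
  have inj: "inj_on F (span B)" by (rule inj_on_subset[OF assms(2) span_mono[OF B(1)]])
  have "card (F ` B) = F.vs2.dim (F ` X)"
  proof (rule F.vs2.basis_card_eq_dim)
    show "F ` B \<subseteq> F ` X" using B by blast
    show "F.vs2.independent (F ` B)" using F.independent_injective_image[OF B(2) inj] .
    show "F ` X \<subseteq> F.vs2.span (F ` B)" unfolding F.span_image by (rule image_mono) (rule B(3))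
  qed
  moreover have "card (F ` B) = card B"
    by (rule card_image) (rule inj_on_subset[OF inj span_superset])
  ultimately show ?thesis using B(4) by simp
qed

end

lemma supported_subspace: "fun_vs.subspace {c :: nat \<Rightarrow> 'a::field. \<forall>i\<ge>p. c i = 0}"
  by (auto simp: fun_vs.subspace_def)

section \<open>Coordinates with respect to an independent family\<close>

text \<open>The linear map taking coordinates to combinations of the independent w is injective on
  functions supported below p, and it sends the columns of N to y.\<close>

lemma rank_expansion:
  assumes N: "N \<in> carrier_mat p q"
    and w: "fun_vs.indep_over {} w {..<p}"
    and y: "\<And>l. l < q \<Longrightarrow> y l = (\<Sum>i<p. fscale (N $$ (i, l)) (w i))"
  shows "vec_space.rank p N = fun_vs.dim (y ` {..<q})"
proof -
  define F where "F c = (\<Sum>i<p. fscale (c i) (w i))" for c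
  have lin: "Vector_Spaces.linear fscale fscale F"
    unfolding F_def Vector_Spaces.linear_iff
    by (auto simp: fun_eq_iff sum.distrib sum_distrib_left algebra_simps fun_vs.vector_space_axioms)
  interpret F: Vector_Spaces.linear fscale fscale F by (rule lin)
  have "col_fun N ` {..<q} \<subseteq> {c. \<forall>i\<ge>p. c i = 0}" using N by (auto simp: col_fun_def)
  then have "fun_vs.span (col_fun N ` {..<q}) \<subseteq> {c. \<forall>i\<ge>p. c i = 0}"
    by (rule fun_vs.span_minimal[OF _ supported_subspace])
  moreover have "inj_on F {c. \<forall>i\<ge>p. c i = 0}"
  proof (rule inj_onI)
    fix c d assume cd: "c \<in> {c. \<forall>i\<ge>p. c i = 0}" "d \<in> {c. \<forall>i\<ge>p. c i = 0}" "F c = F d"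
    then have "F (c - d) = 0" using F.diff by simp
    then have "\<forall>i<p. c i = d i" using w unfolding fun_vs.indep_over_def F_def by auto
    then show "c = d" using cd(1,2) by (auto simp: fun_eq_iff) (metis not_less)
  qed
  ultimately have "inj_on F (fun_vs.span (col_fun N ` {..<q}))" by (rule inj_on_subset[rotated])
  then have "fun_vs.dim (F ` col_fun N ` {..<q}) = fun_vs.dim (col_fun N ` {..<q})"
    by (rule fun_vs.dim_injective_image[OF lin])
  moreover have "F (col_fun N l) = y l" if "l < q" for l
    using y[OF that] N by (simp add: F_def col_fun_def)
  then have "F ` col_fun N ` {..<q} = y ` {..<q}" by (auto simp: image_image)
  ultimately show ?thesis using rank_eq_dim_col_fun[OF N] by simp
qed

lemma full_row_rank_iff:
  assumes N: "N \<in> carrier_mat p q"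
    and w: "fun_vs.indep_over {} w {..<p}"
    and y: "\<And>l. l < q \<Longrightarrow> y l = (\<Sum>i<p. fscale (N $$ (i, l)) (w i))"
  shows "vec_space.rank p N = p \<longleftrightarrow> w ` {..<p} \<subseteq> fun_vs.span (y ` {..<q})"
proof -
  have dw: "fun_vs.dim (w ` {..<p}) = p"
    using fun_vs.indep_over_iff_dim[OF fun_vs.fin_spanned_finite, of "{}" "{..<p}" w] w
    by (simp add: fun_vs.dim_eq_card_independent[OF fun_vs.independent_empty])
  have fsw: "fun_vs.fin_spanned (w ` {..<p})" and fsy: "fun_vs.fin_spanned (y ` {..<q})"
    by (auto intro: fun_vs.fin_spanned_finite)
  have "y l \<in> fun_vs.span (w ` {..<p})" if "l < q" for l
    unfolding y[OF that] by (intro fun_vs.span_sum fun_vs.span_scale fun_vs.span_base) auto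
  then have yw: "y ` {..<q} \<subseteq> fun_vs.span (w ` {..<p})" by blast
  show ?thesis
  proof
    assume "vec_space.rank p N = p"
    then show "w ` {..<p} \<subseteq> fun_vs.span (y ` {..<q})"
      using rank_expansion[OF assms] dw by (intro fun_vs.fin_dim_spans[OF fsw yw]) simp
  next
    assume "w ` {..<p} \<subseteq> fun_vs.span (y ` {..<q})"
    then show "vec_space.rank p N = p"
      using rank_expansion[OF assms] dw fun_vs.fin_dim_mono[OF fsy] fun_vs.fin_dim_mono[OF fsw yw]
      by (metis le_antisym)
  qed
qed

text \<open>Uniqueness of coordinates. Membership in a step of the flag thus becomes vanishing of
  lower rows, which yields both the zero blocks and triangularity.\<close>

lemma mem_span_prefix:
  fixes w :: "nat \<Rightarrow> nat \<Rightarrow> 'a::field"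
  assumes w: "fun_vs.indep_over {} w {..<m}" and d: "d \<le> m"
  shows "(\<Sum>i<m. fscale (c i) (w i)) \<in> fun_vs.span (w ` {..<d}) \<longleftrightarrow> (\<forall>i<m. d \<le> i \<longrightarrow> c i = 0)"
proof
  assume "(\<Sum>i<m. fscale (c i) (w i)) \<in> fun_vs.span (w ` {..<d})"
  then have "\<exists>e. (\<Sum>i<m. fscale (c i) (w i)) - (\<Sum>i<d. fscale (e i) (w i)) \<in> fun_vs.span {}"
    using fun_vs.span_Un_image[OF finite_lessThan[of d], where U = "{}" and x = w] by (simp only: Un_empty_left)
  then obtain e where "(\<Sum>i<m. fscale (c i) (w i)) - (\<Sum>i<d. fscale (e i) (w i)) = 0"
    unfolding fun_vs.span_empty by blast
  moreover define e' where "e' i = (if i < d then e i else 0)" for i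
  have "(\<Sum>i<d. fscale (e i) (w i)) = (\<Sum>i<m. fscale (e' i) (w i))"
    using d by (intro sum.mono_neutral_cong_left) (auto simp: e'_def)
  ultimately have "(\<Sum>i<m. fscale (c i - e' i) (w i)) = 0"
    by (simp add: fun_vs.scale_left_diff_distrib sum_subtractf)
  then have "\<forall>i<m. c i - e' i = 0" using w unfolding fun_vs.indep_over_def by auto
  then show "\<forall>i<m. d \<le> i \<longrightarrow> c i = 0" by (auto simp: e'_def)
next
  assume c: "\<forall>i<m. d \<le> i \<longrightarrow> c i = 0"
  have "(\<Sum>i<m. fscale (c i) (w i)) = (\<Sum>i<d. fscale (c i) (w i))"
    using d c by (intro sum.mono_neutral_right) (auto simp: not_less)
  then show "(\<Sum>i<m. fscale (c i) (w i)) \<in> fun_vs.span (w ` {..<d})"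
    by (simp only:) (intro fun_vs.span_sum fun_vs.span_scale fun_vs.span_base imageI)
qed

text \<open>The last r coordinates of a combination of the y are the same combination of the columns
  of C, and by \<open>mem_span_prefix\<close> they vanish exactly when it lies in the span of the
  first d basis vectors. So C represents y modulo that span.\<close>

lemma full_column_rank_iff:
  assumes C: "C \<in> carrier_mat r s" and m: "m = d + r"
    and w: "fun_vs.indep_over {} w {..<m}"
    and y: "\<And>l. l < s \<Longrightarrow> y l = (\<Sum>i<m. fscale (N i l) (w i))"
    and NC: "\<And>i l. i < r \<Longrightarrow> l < s \<Longrightarrow> N (d + i) l = C $$ (i, l)"
  shows "vec_space.rank r C = s \<longleftrightarrow> fun_vs.indep_over (w ` {..<d}) y {..<s}"
proof -
  have "vec_space.rank r C = s \<longleftrightarrow> fun_vs.indep_over {} (col_fun C) {..<s}"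
    unfolding rank_eq_dim_col_fun[OF C]
    using fun_vs.indep_over_iff_dim[OF fun_vs.fin_spanned_finite, of "{}" "{..<s}" "col_fun C"]
    by (simp add: fun_vs.dim_eq_card_independent[OF fun_vs.independent_empty])
  also have "\<dots> \<longleftrightarrow> fun_vs.indep_over (w ` {..<d}) y {..<s}"
  proof -
    have "(\<Sum>l<s. fscale (c l) (col_fun C l)) = 0 \<longleftrightarrow>
      (\<Sum>l<s. fscale (c l) (y l)) \<in> fun_vs.span (w ` {..<d})" for c
    proof -
      have "(\<Sum>l<s. fscale (c l) (y l)) = (\<Sum>l<s. \<Sum>i<m. fscale (c l * N i l) (w i))"
        by (intro sum.cong) (simp_all add: y fun_vs.scale_sum_right)
      also have "\<dots> = (\<Sum>i<m. fscale (\<Sum>l<s. c l * N i l) (w i))"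
        by (subst sum.swap) (simp add: fun_vs.scale_sum_left)
      finally have "(\<Sum>l<s. fscale (c l) (y l)) \<in> fun_vs.span (w ` {..<d}) \<longleftrightarrow>
          (\<forall>i<m. d \<le> i \<longrightarrow> (\<Sum>l<s. c l * N i l) = 0)"
        using mem_span_prefix[OF w, of d] m by simp
      also have "\<dots> \<longleftrightarrow> (\<forall>i<r. (\<Sum>l<s. c l * N (d + i) l) = 0)"
        unfolding m by (metis add_less_cancel_left le_add1 le_add_diff_inverse)
      also have "\<dots> \<longleftrightarrow> (\<forall>i. (\<Sum>l<s. c l * col_fun C l i) = 0)"
      proof -
        have "(\<Sum>l<s. c l * col_fun C l i) = (if i < r then \<Sum>l<s. c l * N (d + i) l else 0)" for i
          using C by (auto simp: NC col_fun_def intro!: sum.cong sum.neutral)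
        then show ?thesis by simp
      qed
      also have "\<dots> \<longleftrightarrow> (\<Sum>l<s. fscale (c l) (col_fun C l)) = 0"
        by (simp add: fun_eq_iff)
      finally show ?thesis by simp
    qed
    then show ?thesis unfolding fun_vs.indep_over_def by simp
  qed
  finally show ?thesis .
qed

section \<open>Polynomials of degree at most one\<close>

text \<open>The bounds on degree and on indeterminates merge into one condition on monomials, which
  sums and constant multiples preserve.\<close>

definition affine_poly :: "nat set \<Rightarrow> 'a::zero mpoly \<Rightarrow> bool" where
  "affine_poly I p \<longleftrightarrow> Poly_Mapping.keys p \<subseteq> insert 0 ((\<lambda>i. Poly_Mapping.single i 1) ` I)"

lemma monom_degree_le_1:
  "monom_degree m \<le> 1 \<longleftrightarrow> m = 0 \<or> (\<exists>i. m = Poly_Mapping.single i 1)"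
proof
  assume deg: "monom_degree m \<le> 1"
  show "m = 0 \<or> (\<exists>i. m = Poly_Mapping.single i 1)"
  proof (cases "m = 0")
    case False
    then obtain i where i: "i \<in> Poly_Mapping.keys m" by (metis all_not_in_conv keys_eq_empty)
    have "Poly_Mapping.lookup m i + (\<Sum>j\<in>Poly_Mapping.keys m - {i}. Poly_Mapping.lookup m j) \<le> 1"
      using deg i by (simp add: monom_degree_def sum.remove)
    moreover have "Poly_Mapping.lookup m i \<noteq> 0" using i by (simp add: in_keys_iff)
    ultimately have mi: "Poly_Mapping.lookup m i = 1"
      and rest: "(\<Sum>j\<in>Poly_Mapping.keys m - {i}. Poly_Mapping.lookup m j) = 0" by linarith+
    have "m = Poly_Mapping.single i 1"
    proof (rule poly_mapping_eqI)
      fix j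
      show "Poly_Mapping.lookup m j = Poly_Mapping.lookup (Poly_Mapping.single i 1) j"
      proof (cases "j = i")
        case False
        then have "Poly_Mapping.lookup m j = 0"
          using iffD1[OF sum_eq_0_iff rest] in_keys_iff[of j m] finite_keys[of m] by blast
        then show ?thesis using False by (simp add: lookup_single)
      qed (simp add: mi)
    qed
    then show ?thesis by blast
  qed simp
qed (auto simp: monom_degree_def)

lemma affine_poly_iff: "affine_poly I p \<longleftrightarrow> indets p \<subseteq> I \<and> total_degree p \<le> 1"
proof -
  have "total_degree p \<le> 1 \<longleftrightarrow> (\<forall>m\<in>Poly_Mapping.keys p. monom_degree m \<le> 1)"
    by (auto simp: total_degree_def)
  also have "\<dots> \<longleftrightarrow> (\<forall>m\<in>Poly_Mapping.keys p. m = 0 \<or> (\<exists>i. m = Poly_Mapping.single i 1))"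
    unfolding monom_degree_le_1 ..
  finally have deg: "total_degree p \<le> 1 \<longleftrightarrow> \<dots>" .
  show ?thesis
  proof
    assume p: "affine_poly I p"
    have "i \<in> I" if m: "m \<in> Poly_Mapping.keys p" and i: "i \<in> Poly_Mapping.keys m" for m i
    proof -
      consider "m = 0" | j where "j \<in> I" "m = Poly_Mapping.single j 1"
        using p m unfolding affine_poly_def by blast
      then show ?thesis using i by cases auto
    qed
    moreover have "\<forall>m\<in>Poly_Mapping.keys p. m = 0 \<or> (\<exists>i. m = Poly_Mapping.single i 1)"
      using p unfolding affine_poly_def by blast
    ultimately show "indets p \<subseteq> I \<and> total_degree p \<le> 1" unfolding deg indets_def by blast
  next
    assume R: "indets p \<subseteq> I \<and> total_degree p \<le> 1"
    show "affine_poly I p"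
      unfolding affine_poly_def
    proof
      fix m assume m: "m \<in> Poly_Mapping.keys p"
      then consider "m = 0" | i where "m = Poly_Mapping.single i 1" using R unfolding deg by blast
      then show "m \<in> insert 0 ((\<lambda>i. Poly_Mapping.single i 1) ` I)"
      proof cases
        case (2 i)
        then have "i \<in> indets p" using m unfolding indets_def by (intro UN_I[OF m]) simp
        then show ?thesis using 2 R by blast
      qed simp
    qed
  qed
qed

lemma affine_poly_0: "affine_poly I 0"
  by (simp add: affine_poly_def)

lemma affine_poly_add: "affine_poly I p \<Longrightarrow> affine_poly I q \<Longrightarrow> affine_poly I (p + q)"
  for p q :: "'a::monoid_add mpoly"
  unfolding affine_poly_def using keys_add[of p q] by blast

lemma affine_poly_sum:
  "(\<And>i. i \<in> A \<Longrightarrow> affine_poly I (p i)) \<Longrightarrow> affine_poly I (\<Sum>i\<in>A. p i)"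
  for p :: "_ \<Rightarrow> 'a::comm_monoid_add mpoly"
  by (induction A rule: infinite_finite_induct) (simp_all add: affine_poly_0 affine_poly_add)

lemma lookup_const_poly_mult:
  "Poly_Mapping.lookup (const_poly c * p) m = c * Poly_Mapping.lookup p m"
  for p :: "'a::comm_semiring_1 mpoly"
  unfolding const_poly_def mult_map_scale_conv_mult[symmetric]
  by (simp add: Poly_Mapping.map.rep_eq when_def)

lemma affine_poly_const_mult: "affine_poly I p \<Longrightarrow> affine_poly I (const_poly c * p)"
  for p :: "'a::comm_semiring_1 mpoly"
proof -
  have "Poly_Mapping.keys (const_poly c * p) \<subseteq> Poly_Mapping.keys p"
    by (auto simp: in_keys_iff lookup_const_poly_mult)
  then show "affine_poly I p \<Longrightarrow> ?thesis" unfolding affine_poly_def by blast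
qed

lemma eval_poly_superset:
  assumes "finite X" "Poly_Mapping.keys p \<subseteq> X"
  shows "eval_poly f p = (\<Sum>m\<in>X. Poly_Mapping.lookup p m *
    (\<Prod>i\<in>Poly_Mapping.keys m. f i ^ Poly_Mapping.lookup m i))"
  unfolding eval_poly_def using assms
  by (intro sum.mono_neutral_left) (auto simp: in_keys_iff)

lemma eval_poly_0 [simp]: "eval_poly f 0 = 0"
  by (simp add: eval_poly_def)

lemma eval_poly_add: "eval_poly f (p + q) = eval_poly f p + eval_poly f q"
  unfolding eval_poly_superset[of "Poly_Mapping.keys p \<union> Poly_Mapping.keys q" "p + q", OF _ keys_add, simplified]
    eval_poly_superset[of "Poly_Mapping.keys p \<union> Poly_Mapping.keys q" p, simplified]
    eval_poly_superset[of "Poly_Mapping.keys p \<union> Poly_Mapping.keys q" q, simplified]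
  by (simp add: lookup_add sum.distrib distrib_right)

lemma eval_poly_sum: "eval_poly f (\<Sum>i\<in>A. p i) = (\<Sum>i\<in>A. eval_poly f (p i))"
  by (induction A rule: infinite_finite_induct) (simp_all add: eval_poly_add)

lemma eval_poly_const_mult: "eval_poly f (const_poly c * p) = c * eval_poly f p"
proof -
  have "Poly_Mapping.keys (const_poly c * p) \<subseteq> Poly_Mapping.keys p"
    by (auto simp: in_keys_iff lookup_const_poly_mult)
  then show ?thesis
    using eval_poly_superset[of "Poly_Mapping.keys p" "const_poly c * p" f]
    by (simp add: eval_poly_def[of f p] lookup_const_poly_mult sum_distrib_left mult.assoc)
qed

lemma eval_poly_const [simp]: "eval_poly f (const_poly c) = c"
  by (simp add: eval_poly_def const_poly_def)

lemma eval_affine_poly: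
  assumes "affine_poly I p" "finite I"
  shows "eval_poly f p = Poly_Mapping.lookup p 0 +
    (\<Sum>i\<in>I. Poly_Mapping.lookup p (Poly_Mapping.single i 1) * f i)"
proof -
  have inj: "inj_on (\<lambda>i::nat. Poly_Mapping.single i (1::nat)) I"
    by (intro inj_onI) (metis lookup_single_eq lookup_single_not_eq zero_neq_one)
  have "Poly_Mapping.single i (1::nat) \<noteq> 0" for i :: nat
    by (metis lookup_single_eq lookup_zero zero_neq_one)
  then have nz: "(0 :: nat \<Rightarrow>\<^sub>0 nat) \<notin> (\<lambda>i. Poly_Mapping.single i 1) ` I" by (metis imageE)
  have "eval_poly f p = (\<Sum>m\<in>insert 0 ((\<lambda>i. Poly_Mapping.single i 1) ` I). Poly_Mapping.lookup p m *
    (\<Prod>i\<in>Poly_Mapping.keys m. f i ^ Poly_Mapping.lookup m i))"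
    using assms by (intro eval_poly_superset) (auto simp: affine_poly_def)
  also have "\<dots> = Poly_Mapping.lookup p 0 +
    (\<Sum>i\<in>I. Poly_Mapping.lookup p (Poly_Mapping.single i 1) * f i)"
    using nz inj assms(2) by (subst sum.insert) (simp_all add: sum.reindex)
  finally show ?thesis .
qed

text \<open>This is what makes the set of values of a column closed in the sense of
  \<open>affine_closed\<close>.\<close>

lemma eval_affine_poly_line:
  fixes p :: "'a::comm_ring_1 mpoly"
  assumes "affine_poly I p" "finite I"
  shows "eval_poly (\<lambda>i. f i + t * (g i - h i)) p =
    eval_poly f p + t * (eval_poly g p - eval_poly h p)"
  unfolding eval_affine_poly[OF assms]
  by (simp add: algebra_simps sum.distrib sum_distrib_left sum_subtractf)

lemma eval_affine_poly_cong:
  assumes "affine_poly I p" "finite I" "\<And>i. i \<in> I \<Longrightarrow> f i = g i"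
  shows "eval_poly f p = eval_poly g p"
  unfolding eval_affine_poly[OF assms(1,2)] using assms(3) by simp

text \<open>Over a finite field a nonconstant polynomial may be constant as a function, but not in
  degree one: the zero assignment and the unit assignments already determine all
  coefficients.\<close>

lemma affine_poly_const:
  assumes p: "affine_poly I p" "finite I" and c: "\<And>f. eval_poly f p = c"
  shows "p = const_poly (c::'a::comm_ring_1)"
proof (rule poly_mapping_eqI)
  fix m
  have p0: "Poly_Mapping.lookup p 0 = c" using c[of "\<lambda>_. 0"] eval_affine_poly[OF p, of "\<lambda>_. 0"] by simp
  have ps: "Poly_Mapping.lookup p (Poly_Mapping.single i 1) = 0" if "i \<in> I" for i
    using c[of "\<lambda>j. if j = i then 1 else 0"] eval_affine_poly[OF p, of "\<lambda>j. if j = i then 1 else 0"] p0 that p(2)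
    by (simp add: if_distrib[of "\<lambda>x. _ * x"] cong: if_cong)
  show "Poly_Mapping.lookup p m = Poly_Mapping.lookup (const_poly c) m"
  proof (cases "m = 0")
    case False
    have "m \<notin> Poly_Mapping.keys p"
      using p(1) ps False unfolding affine_poly_def by (auto simp: in_keys_iff)
    then show ?thesis using False by (simp add: const_poly_def in_keys_iff lookup_single)
  qed (simp add: p0 const_poly_def)
qed

lemma const_poly_0 [simp]: "const_poly 0 = 0" and const_poly_1 [simp]: "const_poly 1 = 1"
  by (simp_all add: const_poly_def)

section \<open>Indeterminates of the columns\<close>

definition col_indets :: "'a::zero mpoly mat \<Rightarrow> nat \<Rightarrow> nat set" where
  "col_indets A j = (\<Union>i<dim_row A. indets (A $$ (i, j)))"

lemma finite_col_indets [simp]: "finite (col_indets A j)"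
  by (simp add: col_indets_def indets_def)

lemma aci_mat_affine:
  "aci_mat k A \<Longrightarrow> i < dim_row A \<Longrightarrow> j < dim_col A \<Longrightarrow> affine_poly (col_indets A j) (A $$ (i, j))"
  by (auto simp: aci_mat_def affine_poly_iff col_indets_def)

lemma aci_mat_col_indets:
  assumes "aci_mat k A"
  shows "j < dim_col A \<Longrightarrow> col_indets A j \<subseteq> {..<k}"
    and "j < dim_col A \<Longrightarrow> j' < dim_col A \<Longrightarrow> j \<noteq> j' \<Longrightarrow> col_indets A j \<inter> col_indets A j' = {}"
  using assms unfolding aci_mat_def col_indets_def by blast+

lemma aci_matI:
  assumes "\<And>i j. i < dim_row A \<Longrightarrow> j < dim_col A \<Longrightarrow> affine_poly (I j) (A $$ (i, j))"
    and "\<And>j. j < dim_col A \<Longrightarrow> I j \<subseteq> {..<k}"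
    and "\<And>j j'. j < dim_col A \<Longrightarrow> j' < dim_col A \<Longrightarrow> j \<noteq> j' \<Longrightarrow> I j \<inter> I j' = {}"
  shows "aci_mat k A"
  using assms unfolding aci_mat_def affine_poly_iff by blast

text \<open>Columns share no indeterminate, so assignments chosen separately for each column can be merged.\<close>

lemma merge_assignments:
  assumes A: "aci_mat k A"
  shows "\<exists>g. \<forall>i<dim_row A. \<forall>j<dim_col A. eval_poly g (A $$ (i, j)) = eval_poly (f j) (A $$ (i, j))"
proof -
  define g where "g x = f (THE j. j < dim_col A \<and> x \<in> col_indets A j) x" for x
  have "g x = f j x" if "j < dim_col A" "x \<in> col_indets A j" for x j
  proof -
    have "(THE j. j < dim_col A \<and> x \<in> col_indets A j) = j"
      using that aci_mat_col_indets(2)[OF A, of _ j] by (intro the_equality) blast+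
    then show ?thesis by (simp add: g_def)
  qed
  then show ?thesis
    using eval_affine_poly_cong[OF aci_mat_affine[OF A] finite_col_indets] by blast
qed

section \<open>Block forms of constant rank\<close>

lemma equiv_index:
  fixes A :: "'a::field mpoly mat"
  assumes A: "A \<in> carrier_mat m n" and T: "T \<in> carrier_mat m m"
    and \<sigma>: "\<sigma> permutes {..<n}" and il: "i < m" "l < n"
  shows "(map_mat const_poly T * A *
      map_mat const_poly (mat n n (\<lambda>(i, j). if i = \<sigma> j then 1 else 0))) $$ (i, l)
    = (\<Sum>h<m. const_poly (T $$ (i, h)) * A $$ (h, \<sigma> l))"
proof -
  have \<sigma>l: "\<sigma> l < n" using permutes_in_image[OF \<sigma>, of l] il(2) by simp
  define TA where "TA = map_mat const_poly T * A"
  have TA: "TA \<in> carrier_mat m n" using A T by (simp add: TA_def)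
  have "(TA * map_mat const_poly (mat n n (\<lambda>(i, j). if i = \<sigma> j then 1 else 0))) $$ (i, l)
    = (\<Sum>j = 0..<n. TA $$ (i, j) * (if j = \<sigma> l then 1 else 0))"
    using TA il by (auto simp: scalar_prod_def intro!: sum.cong)
  also have "\<dots> = TA $$ (i, \<sigma> l)"
    using \<sigma>l by (simp add: if_distrib[of "\<lambda>x. _ * x"] cong: if_cong)
  also have "\<dots> = (\<Sum>h<m. const_poly (T $$ (i, h)) * A $$ (h, \<sigma> l))"
    using A T il(1) \<sigma>l by (simp add: TA_def scalar_prod_def atLeast0LessThan)
  finally show ?thesis by (simp add: TA_def)
qed

text \<open>From \<open>A = S * (T * A)\<close>: the columns of the inverse S of T serve as basis,
  and the entries of \<open>T * A\<close> are the coordinates in it.\<close>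

lemma column_expansion:
  fixes A :: "'a::field mpoly mat"
  assumes A: "A \<in> carrier_mat m n" and ST: "S \<in> carrier_mat m m" "T \<in> carrier_mat m m" "S * T = 1\<^sub>m m"
    and j: "j < n"
  shows "col_fun (completion f A) j =
    (\<Sum>i<m. fscale (eval_poly f (\<Sum>h<m. const_poly (T $$ (i, h)) * A $$ (h, j))) (col_fun S i))"
proof
  fix u
  show "col_fun (completion f A) j u =
    (\<Sum>i<m. fscale (eval_poly f (\<Sum>h<m. const_poly (T $$ (i, h)) * A $$ (h, j))) (col_fun S i)) u"
  proof (cases "u < m")
    case True
    have ST': "(\<Sum>i<m. S $$ (u, i) * T $$ (i, h)) = (if u = h then 1 else 0)" if "h < m" for h
    proof -
      have "(S * T) $$ (u, h) = (\<Sum>i<m. S $$ (u, i) * T $$ (i, h))"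
        using ST(1,2) True that by (simp add: scalar_prod_def atLeast0LessThan)
      then show ?thesis using ST(3) True that by simp
    qed
    have "(\<Sum>i<m. fscale (eval_poly f (\<Sum>h<m. const_poly (T $$ (i, h)) * A $$ (h, j))) (col_fun S i)) u
      = (\<Sum>i<m. \<Sum>h<m. (S $$ (u, i) * T $$ (i, h)) * eval_poly f (A $$ (h, j)))"
      using ST(1) True
      by (simp add: col_fun_def eval_poly_sum eval_poly_const_mult sum_distrib_right) (simp add: mult_ac)
    also have "\<dots> = (\<Sum>h<m. (\<Sum>i<m. S $$ (u, i) * T $$ (i, h)) * eval_poly f (A $$ (h, j)))"
      by (subst sum.swap) (simp add: sum_distrib_right)
    also have "\<dots> = (\<Sum>h<m. (if u = h then 1 else 0) * eval_poly f (A $$ (h, j)))"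
      by (intro sum.cong) (simp_all add: ST')
    also have "\<dots> = eval_poly f (A $$ (u, j))"
      using True by (simp add: if_distrib[of "\<lambda>x. x * _"] cong: if_cong)
    finally show ?thesis using True A j by (simp add: col_fun_def completion_def)
  next
    case False
    then show ?thesis using A ST(1) by (simp add: col_fun_def completion_def)
  qed
qed

lemma indep_over_col_fun_invertible:
  fixes S :: "'a::field mat"
  assumes ST: "S \<in> carrier_mat m m" "T \<in> carrier_mat m m" "T * S = 1\<^sub>m m"
  shows "fun_vs.indep_over {} (col_fun S) {..<m}"
  unfolding fun_vs.indep_over_def fun_vs.span_empty
proof (intro allI impI ballI)
  fix c j assume c: "(\<Sum>i<m. fscale (c i) (col_fun S i)) \<in> {0}" and "j \<in> {..<m}"
  then have j: "j < m" by simp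
  have TS: "(\<Sum>u<m. T $$ (j, u) * S $$ (u, i)) = (if j = i then 1 else 0)" if "i < m" for i
  proof -
    have "(T * S) $$ (j, i) = (\<Sum>u<m. T $$ (j, u) * S $$ (u, i))"
      using ST(1,2) j that by (simp add: scalar_prod_def atLeast0LessThan)
    then show ?thesis using ST(3) j that by simp
  qed
  have z: "(\<Sum>i<m. c i * S $$ (u, i)) = 0" if "u < m" for u
  proof -
    have "(\<Sum>i<m. fscale (c i) (col_fun S i)) u = 0" using c by simp
    then show ?thesis using ST(1) that by (simp add: col_fun_def)
  qed
  have "0 = (\<Sum>u<m. T $$ (j, u) * (\<Sum>i<m. c i * S $$ (u, i)))" by (simp add: z)
  also have "\<dots> = (\<Sum>u<m. \<Sum>i<m. c i * (T $$ (j, u) * S $$ (u, i)))"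
    by (simp add: sum_distrib_left mult_ac)
  also have "\<dots> = (\<Sum>i<m. c i * (\<Sum>u<m. T $$ (j, u) * S $$ (u, i)))"
    by (subst sum.swap) (simp add: sum_distrib_left)
  also have "\<dots> = (\<Sum>i<m. c i * (if j = i then 1 else 0))"
    by (intro sum.cong) (simp_all add: TS)
  also have "\<dots> = c j" using j by (simp add: if_distrib[of "\<lambda>x. _ * x"] cong: if_cong)
  finally show "c j = 0" by simp
qed

lemma
  assumes "B \<in> carrier_mat p q" "X \<in> carrier_mat p b" "Y \<in> carrier_mat p s"
    "Z \<in> carrier_mat a s" "C \<in> carrier_mat r s"
  shows block_form_carrier: "block_form B X Y Z C \<in> carrier_mat (p + a + r) (q + b + s)"
    and block_form_index: "i < p + a + r \<Longrightarrow> j < q + b + s \<Longrightarrow> block_form B X Y Z C $$ (i, j) =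
      (if i < p then
         if j < q then B $$ (i, j) else if j < q + b then X $$ (i, j - q) else Y $$ (i, j - (q + b))
       else if j < q + b then 0
       else if i < p + a then Z $$ (i - p, j - (q + b)) else C $$ (i - (p + a), j - (q + b)))"
proof -
  note d = assms[THEN carrier_matD(1)] assms[THEN carrier_matD(2)]
  show "block_form B X Y Z C \<in> carrier_mat (p + a + r) (q + b + s)"
    by (rule carrier_matI) (simp_all add: block_form_def append_rows_def d)
  show "block_form B X Y Z C $$ (i, j) =
      (if i < p then
         if j < q then B $$ (i, j) else if j < q + b then X $$ (i, j - q) else Y $$ (i, j - (q + b))
       else if j < q + b then 0
       else if i < p + a then Z $$ (i - p, j - (q + b)) else C $$ (i - (p + a), j - (q + b)))"
    if "i < p + a + r" "j < q + b + s"
    unfolding block_form_def append_rows_def using that by (auto simp: d)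
qed

lemma upper_triangular_const_diag_rank:
  fixes B :: "'a::field mpoly mat"
  assumes "upper_triangular_const_diag B"
  shows "constant_rank B (dim_row B)"
  unfolding constant_rank_def
proof
  fix f :: "nat \<Rightarrow> 'a"
  define n where "n = dim_row B"
  have sq: "dim_col B = n" and ut: "\<And>i j. i < n \<Longrightarrow> j < i \<Longrightarrow> B $$ (i, j) = 0"
    and diag: "\<And>i. i < n \<Longrightarrow> \<exists>c. c \<noteq> 0 \<and> B $$ (i, i) = const_poly c"
    using assms unfolding upper_triangular_const_diag_def n_def by auto
  have carr: "completion f B \<in> carrier_mat n n"
    unfolding completion_def by (rule carrier_matI) (simp_all add: sq, simp add: n_def)
  have d: "completion f B $$ (i, i) \<noteq> 0" if "i < n" for i
  proof -
    obtain c where "c \<noteq> 0" "B $$ (i, i) = const_poly c" using diag[OF \<open>i < n\<close>] by blast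
    then show ?thesis using \<open>i < n\<close> sq by (simp add: completion_def n_def)
  qed
  have "upper_triangular (completion f B)"
    using sq ut by (auto simp: completion_def n_def)
  from det_upper_triangular[OF this carr] have "det (completion f B) \<noteq> 0"
    using d carr by (auto simp: diag_mat_def prod_list_zero_iff)
  then show "vec_space.rank (dim_row B) (completion f B) = dim_row B"
    using vec_space.det_rank_iff[OF carr] n_def by simp
qed

text \<open>In the basis formed by the columns of the inverse of T, the first \<open>q + b\<close>
  columns lie in the span of the first p basis vectors, and those of B already span it. The last s
  columns are independent modulo the first \<open>p + a\<close> basis vectors, so they add exactly s
  to the rank.\<close>

lemma block_form_constant_rank:
  fixes A :: "'a::field mpoly mat"
  assumes A: "A \<in> carrier_mat m n"
    and carr: "B \<in> carrier_mat p q" "X \<in> carrier_mat p b" "Y \<in> carrier_mat p s"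
      "Z \<in> carrier_mat a s" "C \<in> carrier_mat r s"
    and eq: "aci_equiv A (block_form B X Y Z C)"
    and B: "constant_rank B p" and C: "constant_rank C s"
  shows "constant_rank A (p + s)"
  unfolding constant_rank_def
proof
  fix f :: "nat \<Rightarrow> 'a"
  obtain T Q where T: "T \<in> carrier_mat m m" "invertible_mat T"
    and Q: "permutation_mat n Q" and M: "map_mat const_poly T * A * map_mat const_poly Q = block_form B X Y Z C"
    using eq A unfolding aci_equiv_def by auto
  obtain \<sigma> where \<sigma>: "\<sigma> permutes {..<n}" and Qd: "Q = mat n n (\<lambda>(i, j). if i = \<sigma> j then 1 else 0)"
    using Q unfolding permutation_mat_def by blast
  obtain S where "inverts_mat T S" "inverts_mat S T" using T(2) unfolding invertible_mat_def by blast
  then have TS: "T * S = 1\<^sub>m m" and ST': "S * T = 1\<^sub>m (dim_row S)" using T(1) unfolding inverts_mat_def by auto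
  have "dim_col S = m" using arg_cong[OF TS, of dim_col] by simp
  moreover have "dim_row S = m" using arg_cong[OF ST', of dim_col] T(1) by simp
  ultimately have S: "S \<in> carrier_mat m m" "S * T = 1\<^sub>m m" using ST' by auto
  have "dim_row (block_form B X Y Z C) = m" "dim_col (block_form B X Y Z C) = n"
    unfolding M[symmetric] using T(1) by (simp_all add: Qd)
  then have m: "m = p + a + r" and n: "n = q + b + s" using block_form_carrier[OF carr] by auto
  define w where "w = col_fun S"
  define y where "y l = col_fun (completion f A) (\<sigma> l)" for l
  define N where "N i l = eval_poly f (block_form B X Y Z C $$ (i, l))" for i l
  have \<sigma>n: "\<sigma> l < n" if "l < n" for l using permutes_in_image[OF \<sigma>, of l] that by simp
  have y: "y l = (\<Sum>i<m. fscale (N i l) (w i))" if "l < n" for l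
    unfolding y_def N_def w_def M[symmetric] Qd
    using column_expansion[OF A S(1) T(1) S(2) \<sigma>n[OF that], of f] equiv_index[OF A T(1) \<sigma> _ that] by simp
  have w: "fun_vs.indep_over {} w {..<m}"
    unfolding w_def by (rule indep_over_col_fun_invertible[OF S(1) T(1) TS])
  have wp: "fun_vs.indep_over {} w {..<p}" by (rule fun_vs.indep_over_subset[OF w]) (auto simp: m)
  have yW: "y l = (\<Sum>i<p. fscale (N i l) (w i))" if "l < q + b" for l
  proof -
    have "y l = (\<Sum>i<m. fscale (N i l) (w i))" using y that n by simp
    also have "\<dots> = (\<Sum>i<p. fscale (N i l) (w i))"
      using that by (intro sum.mono_neutral_right)
        (auto simp: m n N_def block_form_index[OF carr] fun_eq_iff)
    finally show ?thesis .
  qed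
  have "w ` {..<p} \<subseteq> fun_vs.span (y ` {..<q})"
  proof (rule iffD1[OF full_row_rank_iff[where N = "completion f B"]])
    show "completion f B \<in> carrier_mat p q" using carr(1) by (simp add: completion_def)
    show "y l = (\<Sum>i<p. fscale (completion f B $$ (i, l)) (w i))" if "l < q" for l
      using that carr(1) yW[of l] by (simp add: N_def block_form_index[OF carr] completion_def)
    show "vec_space.rank p (completion f B) = p" using B carr(1) unfolding constant_rank_def by auto
  qed (rule wp)
  also have "\<dots> \<subseteq> fun_vs.span (y ` {..<n})" by (intro fun_vs.span_mono image_mono) (auto simp: n)
  finally have Wy: "w ` {..<p} \<subseteq> fun_vs.span (y ` {..<n})" .
  define z where "z l = y (q + b + l)" for l
  have "fun_vs.indep_over (w ` {..<p + a}) z {..<s}"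
  proof (rule iffD1[OF full_column_rank_iff[where C = "completion f C" and N = "\<lambda>i l. N i (q + b + l)"]])
    show "completion f C \<in> carrier_mat r s" using carr(5) by (simp add: completion_def)
    show "m = p + a + r" by (rule m)
    show "z l = (\<Sum>i<m. fscale (N i (q + b + l)) (w i))" if "l < s" for l
      using y[of "q + b + l"] that n by (simp add: z_def)
    show "N (p + a + i) (q + b + l) = completion f C $$ (i, l)" if "i < r" "l < s" for i l
      using that carr(5) by (simp add: N_def block_form_index[OF carr] completion_def)
    show "vec_space.rank r (completion f C) = s" using C carr(5) unfolding constant_rank_def by auto
  qed (rule w)
  \<comment> \<open>Independence modulo a larger subspace implies independence modulo a smaller one;
    this is why the block Z does not affect the rank.\<close>
  moreover have "fun_vs.span (w ` {..<p}) \<subseteq> fun_vs.span (w ` {..<p + a})"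
    by (intro fun_vs.span_mono image_mono) auto
  ultimately have "fun_vs.indep_over (w ` {..<p}) z {..<s}"
    unfolding fun_vs.indep_over_def by blast
  then have "fun_vs.dim (w ` {..<p} \<union> z ` {..<s}) = fun_vs.dim (w ` {..<p}) + s"
    using fun_vs.indep_over_iff_dim[OF fun_vs.fin_spanned_finite, of "w ` {..<p}" "{..<s}" z] by simp
  moreover have "fun_vs.dim (w ` {..<p}) = p"
    using fun_vs.indep_over_iff_dim[OF fun_vs.fin_spanned_finite, of "{}" "{..<p}" w] wp
    by (simp add: fun_vs.dim_eq_card_independent[OF fun_vs.independent_empty])
  moreover have "fun_vs.span (w ` {..<p} \<union> z ` {..<s}) = fun_vs.span (y ` {..<n})"
    unfolding fun_vs.span_eq
  proof
    have "z ` {..<s} \<subseteq> y ` {..<n}" by (auto simp: z_def n)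
    then show "w ` {..<p} \<union> z ` {..<s} \<subseteq> fun_vs.span (y ` {..<n})"
      using Wy fun_vs.span_superset[of "y ` {..<n}"] by blast
    show "y ` {..<n} \<subseteq> fun_vs.span (w ` {..<p} \<union> z ` {..<s})"
    proof (rule image_subsetI)
      fix l assume "l \<in> {..<n}"
      then have l: "l < n" by simp
      show "y l \<in> fun_vs.span (w ` {..<p} \<union> z ` {..<s})"
      proof (cases "l < q + b")
        case True
        show ?thesis unfolding yW[OF True]
          by (intro fun_vs.span_sum fun_vs.span_scale fun_vs.span_base UnI1 imageI)
      next
        case False
        then have "y l = z (l - (q + b))" "l - (q + b) < s" using l n by (auto simp: z_def)
        then show ?thesis by (auto intro: fun_vs.span_base)
      qed
    qed
  qed
  moreover have "y ` {..<n} = col_fun (completion f A) ` {..<n}"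
    using permutes_image[OF \<sigma>] unfolding y_def by (metis image_image)
  ultimately have "fun_vs.dim (col_fun (completion f A) ` {..<n}) = p + s"
    using fun_vs.span_eq_dim by metis
  moreover have "completion f A \<in> carrier_mat m n" using A by (simp add: completion_def)
  ultimately show "vec_space.rank (dim_row A) (completion f A) = p + s"
    unfolding carrier_matD(1)[OF A] by (simp only: rank_eq_dim_col_fun)
qed

section \<open>Reduction to block form\<close>

lemma standard_basis:
  fixes e :: "nat \<Rightarrow> nat \<Rightarrow> 'a::field"
  defines "e \<equiv> \<lambda>k i. if i = k then 1 else 0"
  shows "fun_vs.dim (e ` {..<m}) = m"
    and "fun_vs.span (e ` {..<m}) = {c. \<forall>i\<ge>m. c i = 0}"
proof -
  have ex: "(\<Sum>k<m. fscale (c k) (e k)) = (\<lambda>i. if i < m then c i else 0)" for c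
    by (rule ext) (simp add: e_def if_distrib[of "\<lambda>x. _ * x"] cong: if_cong)
  have "fun_vs.indep_over {} e {..<m}"
    unfolding fun_vs.indep_over_def fun_vs.span_empty ex by (auto simp: fun_eq_iff)
  then show "fun_vs.dim (e ` {..<m}) = m"
    using fun_vs.indep_over_iff_dim[OF fun_vs.fin_spanned_finite, of "{}" "{..<m}" e]
    by (simp add: fun_vs.dim_eq_card_independent[OF fun_vs.independent_empty])
  show "fun_vs.span (e ` {..<m}) = {c. \<forall>i\<ge>m. c i = 0}"
  proof
    show "fun_vs.span (e ` {..<m}) \<subseteq> {c. \<forall>i\<ge>m. c i = 0}"
      by (rule fun_vs.span_minimal[OF _ supported_subspace]) (auto simp: e_def)
    show "{c. \<forall>i\<ge>m. c i = 0} \<subseteq> fun_vs.span (e ` {..<m})"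
    proof
      fix c :: "nat \<Rightarrow> 'a" assume "c \<in> {c. \<forall>i\<ge>m. c i = 0}"
      then have "c = (\<Sum>k<m. fscale (c k) (e k))" unfolding ex by (auto simp: fun_eq_iff)
      also have "\<dots> \<in> fun_vs.span (e ` {..<m})"
        by (intro fun_vs.span_sum fun_vs.span_scale fun_vs.span_base imageI)
      finally show "c \<in> fun_vs.span (e ` {..<m})" .
    qed
  qed
qed

text \<open>Expressing each unit vector through w gives a right inverse of the matrix with columns
  w, and for square matrices it is two-sided.\<close>

lemma invertible_of_spanning:
  fixes w :: "nat \<Rightarrow> nat \<Rightarrow> 'a::field"
  assumes w: "fun_vs.span (w ` {..<m}) = {c. \<forall>i\<ge>m. c i = 0}"
  obtains S T where "S \<in> carrier_mat m m" "T \<in> carrier_mat m m" "S * T = 1\<^sub>m m" "T * S = 1\<^sub>m m"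
    "\<And>i. i < m \<Longrightarrow> col_fun S i = w i"
proof -
  define S where "S = mat m m (\<lambda>(u, i). w i u)"
  have "\<exists>t. \<forall>u. (\<Sum>i<m. t i * w i u) = (if u = k then 1 else 0)" if "k < m" for k
  proof -
    have "(\<lambda>u. if u = k then 1 else 0) \<in> fun_vs.span ({} \<union> w ` {..<m})" using that by (simp add: w)
    then obtain t where "(\<lambda>u. if u = k then 1 else 0) - (\<Sum>i<m. fscale (t i) (w i)) \<in> fun_vs.span {}"
      using fun_vs.span_Un_image[OF finite_lessThan] by blast
    then have "(\<Sum>i<m. fscale (t i) (w i)) = (\<lambda>u. if u = k then 1 else 0)" by simp
    then have "(\<Sum>i<m. fscale (t i) (w i)) u = (if u = k then 1 else 0)" for u by (rule fun_cong)
    then show ?thesis by (intro exI[of _ t]) simp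
  qed
  then obtain t where t: "\<And>k u. k < m \<Longrightarrow> (\<Sum>i<m. t k i * w i u) = (if u = k then 1 else 0)" by metis
  define T where "T = mat m m (\<lambda>(i, k). t k i)"
  have carr: "S \<in> carrier_mat m m" "T \<in> carrier_mat m m" by (simp_all add: S_def T_def)
  have ST: "S * T = 1\<^sub>m m"
    using t by (intro eq_matI) (simp_all add: S_def T_def scalar_prod_def atLeast0LessThan mult.commute)
  have "w i u = 0" if "i < m" "u \<ge> m" for i u
    using w fun_vs.span_superset[of "w ` {..<m}"] that by blast
  then have "col_fun S i = w i" if "i < m" for i
    using that by (auto simp: col_fun_def S_def fun_eq_iff)
  then show thesis using that[OF carr ST mat_mult_left_right_inverse[OF carr ST]] by blast
qed

lemma image_skip: "j < q \<Longrightarrow> (\<lambda>l. if l < j then l else Suc l) ` {..<q - 1} = {..<q} - {j}"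
proof (intro equalityI subsetI)
  fix x assume j: "j < q" and x: "x \<in> {..<q} - {j}"
  show "x \<in> (\<lambda>l. if l < j then l else Suc l) ` {..<q - 1}"
  proof (cases "x < j")
    case True
    then show ?thesis using j by (intro image_eqI[of _ _ x]) auto
  next
    case False
    then show ?thesis using x by (intro image_eqI[of _ _ "x - 1"]) auto
  qed
qed auto

text \<open>The sets \<open>S j\<close> of values of the columns are fed into
  \<open>constant_rank_structure\<close>; T is the inverse of the matrix with columns w, and Q
  orders the columns by the resulting bijection. The remaining work turns statements about all
  completions into statements about polynomial entries.\<close>

lemma constant_rank_block_form:
  fixes A :: "'a::field mpoly mat"
  assumes A: "A \<in> carrier_mat m n" "aci_mat k A" and rank: "constant_rank A \<rho>"
  shows "\<exists>p q r s a b B X Y Z C.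
       B \<in> carrier_mat p q \<and> X \<in> carrier_mat p b \<and> Y \<in> carrier_mat p s \<and>
       Z \<in> carrier_mat a s \<and> C \<in> carrier_mat r s \<and>
       aci_mat k B \<and> aci_mat k C \<and> aci_mat k (block_form B X Y Z C) \<and>
       aci_equiv A (block_form B X Y Z C) \<and>
       (upper_triangular_const_diag B \<or> minimal_full_rank B) \<and>
       (upper_triangular_const_diag C \<or> maximal_full_rank C) \<and>
       p + s = \<rho>"
proof -
  define x where "x f j = col_fun (completion f A) j" for f j
  define S where "S j = range (\<lambda>f. x f j)" for j
  define tr where "tr z \<longleftrightarrow> (\<forall>j<n. z j \<in> S j)" for z
  have trx: "tr (x f)" for f by (auto simp: tr_def S_def)
  have x_index: "x f j i = (if i < m then eval_poly f (A $$ (i, j)) else 0)" if "j < n" for f j i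
    using A(1) that by (auto simp: x_def col_fun_def completion_def)
  \<comment> \<open>Every transversal comes from a single assignment, because the assignments of the
    separate columns can be merged; so transversals and completions correspond.\<close>
  have tr_ex: "\<exists>f. \<forall>j<n. z j = x f j" if "tr z" for z
  proof -
    have "\<forall>j<n. \<exists>f. z j = x f j" using that by (auto simp: tr_def S_def)
    then obtain f where f: "\<forall>j<n. z j = x (f j) j" by metis
    obtain g where "\<forall>i<m. \<forall>j<n. eval_poly g (A $$ (i, j)) = eval_poly (f j) (A $$ (i, j))"
      using merge_assignments[OF A(2), of f] A(1) by auto
    then have "\<forall>j<n. z j = x g j" using f by (auto simp: x_index)
    then show ?thesis by (intro exI[of _ g])
  qed
  note aff = aci_mat_affine[OF A(2), unfolded carrier_matD[OF A(1)]]
  define e :: "nat \<Rightarrow> nat \<Rightarrow> 'a" where "e = (\<lambda>k i. if i = k then 1 else 0)"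
  have dimV: "fun_vs.dim (e ` {..<m}) = m"
    and spanV: "fun_vs.span (e ` {..<m}) = {c. \<forall>i\<ge>m. c i = 0}"
    unfolding e_def by (rule standard_basis)+
  have S: "S j \<noteq> {} \<and> fun_vs.affine_closed (S j) \<and> S j \<subseteq> fun_vs.span (e ` {..<m})" if j: "j < n" for j
  proof (intro conjI)
    show "S j \<noteq> {}" by (simp add: S_def)
    show "S j \<subseteq> fun_vs.span (e ` {..<m})" unfolding spanV S_def using x_index[OF j] by auto
    have "x f j + fscale t (x g j - x h j) = x (\<lambda>i. f i + t * (g i - h i)) j" for f g h t
      using eval_affine_poly_line[OF aff[OF _ j] finite_col_indets, of _ f t g h]
      by (auto simp: x_index[OF j] fun_eq_iff)
    then have "x f j + fscale t (x g j - x h j) \<in> S j" for f g h t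
      unfolding S_def by (simp only:) (rule rangeI)
    then show "fun_vs.affine_closed (S j)"
      unfolding fun_vs.affine_closed_def by (auto simp: S_def)
  qed
  have "fun_vs.dim (z ` {..<n}) = \<rho>" if "tr z" for z
  proof -
    obtain f where f: "\<forall>j<n. z j = x f j" using tr_ex[OF \<open>tr z\<close>] by blast
    have "completion f A \<in> carrier_mat m n" using A by (simp add: completion_def)
    from rank_eq_dim_col_fun[OF this] have "fun_vs.dim (x f ` {..<n}) = \<rho>"
      using rank A(1) unfolding constant_rank_def x_def by auto
    moreover have "z ` {..<n} = x f ` {..<n}" using f by (intro image_cong) auto
    ultimately show ?thesis by simp
  qed
  note decomposition = fun_vs.constant_rank_structure[where S = S,
    OF fun_vs.fin_spanned_finite[OF finite_imageI[OF finite_lessThan]] dimV S this[unfolded tr_def], folded tr_def]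
  obtain p a r q b s \<tau> w where \<tau>: "bij_betw \<tau> {..<n} {..<n}"
    and n: "n = q + b + s" and m: "m = p + a + r" and \<rho>: "\<rho> = p + s"
    and spanw: "fun_vs.span (w ` {..<m}) = fun_vs.span (e ` {..<m})"
    and SW: "\<forall>l<q + b. S (\<tau> l) \<subseteq> fun_vs.span (w ` {..<p})"
    and Wspan: "\<forall>z. tr z \<longrightarrow> w ` {..<p} \<subseteq> fun_vs.span (z ` \<tau> ` {..<q})"
    and Cind: "\<forall>z. tr z \<longrightarrow> fun_vs.indep_over (w ` {..<p + a}) (\<lambda>l. z (\<tau> (q + b + l))) {..<s}"
    and Bcase: "q = p \<and> (\<forall>i<p. \<forall>y\<in>S (\<tau> i). y - w i \<in> fun_vs.span (w ` {..<i})) \<or>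
     p < q \<and> (\<forall>l<q. \<exists>z. tr z \<and> \<not> w ` {..<p} \<subseteq> fun_vs.span (z ` \<tau> ` ({..<q} - {l})))"
    and Ccase: "r = s \<and> (\<forall>i<s. \<forall>y\<in>S (\<tau> (q + b + i)).
        y - w (p + a + i) \<in> fun_vs.span (w ` {..<p + a + i})) \<or>
     s < r \<and> (\<forall>v\<in>fun_vs.span (e ` {..<m}). v \<notin> fun_vs.span (w ` {..<p + a}) \<longrightarrow>
       (\<exists>z. tr z \<and> \<not> fun_vs.indep_over (insert v (w ` {..<p + a})) (\<lambda>l. z (\<tau> (q + b + l))) {..<s}))"
    by (rule exE[OF decomposition], assumption, assumption, elim exE conjE, rule that, assumption+)
  \<comment> \<open>\<open>permutes\<close> demands the identity outside \<open>{..<n}\<close>,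
    where nothing is known about \<open>\<tau>\<close>.\<close>
  define \<sigma> where "\<sigma> l = (if l < n then \<tau> l else l)" for l
  have \<tau>n: "\<tau> l < n" if "l < n" for l using \<tau> that unfolding bij_betw_def by blast
  have \<sigma>: "\<sigma> permutes {..<n}"
  proof (rule bij_imp_permutes)
    show "bij_betw \<sigma> {..<n} {..<n}" using \<tau> by (subst bij_betw_cong[of _ _ \<tau>]) (auto simp: \<sigma>_def)
  qed (simp add: \<sigma>_def)
  have "fun_vs.span (w ` {..<m}) = {c. \<forall>i\<ge>m. c i = 0}" using spanw spanV by simp
  then obtain P T where P: "P \<in> carrier_mat m m" and T: "T \<in> carrier_mat m m" and PT: "P * T = 1\<^sub>m m"
    and TP: "T * P = 1\<^sub>m m" and Pw: "\<And>i. i < m \<Longrightarrow> col_fun P i = w i"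
    by (rule invertible_of_spanning) (rule that)
  define Q where "Q = mat n n (\<lambda>(i, j). if i = \<sigma> j then 1 else (0::'a))"
  define M where "M = map_mat const_poly T * A * map_mat const_poly Q"
  have M_carr: "M \<in> carrier_mat m n"
    unfolding M_def by (rule carrier_matI) (simp_all add: Q_def carrier_matD(1)[OF T])
  have M_index: "M $$ (i, l) = (\<Sum>h<m. const_poly (T $$ (i, h)) * A $$ (h, \<tau> l))"
    if "i < m" "l < n" for i l
    unfolding M_def Q_def using equiv_index[OF A(1) T \<sigma> that] that(2) by (simp add: \<sigma>_def)
  define I where "I l = col_indets A (\<tau> l)" for l
  have I_sub: "I l \<subseteq> {..<k}" if "l < n" for l
    unfolding I_def using aci_mat_col_indets(1)[OF A(2)] carrier_matD(2)[OF A(1)] \<tau>n[OF that] by simp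
  have I_disj: "I l \<inter> I l' = {}" if "l < n" "l' < n" "l \<noteq> l'" for l l'
  proof -
    have "\<tau> l \<noteq> \<tau> l'" using inj_onD[OF bij_betw_imp_inj_on[OF \<tau>], of l l'] that by auto
    then show ?thesis
      unfolding I_def using aci_mat_col_indets(2)[OF A(2)] carrier_matD(2)[OF A(1)] \<tau>n that by simp
  qed
  have M_aff: "affine_poly (I l) (M $$ (i, l))" if "i < m" "l < n" for i l
    unfolding M_index[OF that] I_def
    by (intro affine_poly_sum affine_poly_const_mult aff \<tau>n that(2)) simp
  have M_aci: "aci_mat k M"
    by (rule aci_matI[of _ I]) (simp_all only: carrier_matD[OF M_carr] M_aff I_sub I_disj not_False_eq_True)
  define N where "N f i l = eval_poly f (M $$ (i, l))" for f i l
  \<comment> \<open>An entry with the same value under all assignments is that constant as a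
    polynomial, so the zero blocks and the triangular shape hold for M itself and not only for its
    completions.\<close>
  have M_const: "M $$ (i, l) = const_poly c" if "i < m" "l < n" "\<And>f. N f i l = c" for i l c
    by (rule affine_poly_const[OF M_aff[OF that(1,2)]]) (use that(3) in \<open>simp_all add: N_def I_def\<close>)
  define y where "y f l = x f (\<tau> l)" for f l
  have yS: "y f l \<in> S (\<tau> l)" for f l by (simp add: y_def S_def)
  have y: "y f l = (\<Sum>i<m. fscale (N f i l) (w i))" if "l < n" for f l
    unfolding y_def N_def x_def column_expansion[OF A(1) P T PT \<tau>n[OF that], of f]
    by (intro sum.cong) (simp_all add: M_index that Pw)
  have w: "fun_vs.indep_over {} w {..<m}"
    using indep_over_col_fun_invertible[OF P T TP]
    by (subst fun_vs.indep_over_cong[where y = "col_fun P" and U' = "{}"]) (simp_all add: Pw)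
  have wp: "fun_vs.indep_over {} w {..<p}" by (rule fun_vs.indep_over_subset[OF w]) (auto simp: m)
  have zero: "M $$ (i, l) = 0" if "p \<le> i" "i < m" "l < q + b" for i l
  proof -
    have "N f i l = 0" for f
    proof -
      have "y f l \<in> fun_vs.span (w ` {..<p})" using yS SW that(3) by blast
      then show ?thesis using mem_span_prefix[OF w, of p] y[of l f] that n m by simp
    qed
    then show ?thesis using M_const[of i l 0] that n by simp
  qed
  \<comment> \<open>Modulo the earlier basis vectors column l always equals \<open>w i'\<close>, so
    from row \<open>i'\<close> on it has the coordinates of \<open>w i'\<close>. The diagonal
    constants thus come out as 1.\<close>
  have tri: "M $$ (i, l) = const_poly (if i = i' then 1 else 0)"
    if "l < n" "i' \<le> i" "i < m" "\<forall>v\<in>S (\<tau> l). v - w i' \<in> fun_vs.span (w ` {..<i'})" for i i' l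
  proof (rule M_const[OF that(3,1)])
    fix f
    have "y f l - w i' \<in> fun_vs.span (w ` {..<i'})" using that(4) yS by blast
    moreover have "w i' = (\<Sum>i<m. fscale (if i = i' then 1 else 0) (w i))"
      using that(2,3) by (simp add: fun_eq_iff if_distrib[of "\<lambda>x. x * _"] cong: if_cong)
    then have "y f l - w i' = (\<Sum>i<m. fscale (N f i l - (if i = i' then 1 else 0)) (w i))"
      unfolding y[OF that(1)] by (simp add: fun_vs.scale_left_diff_distrib sum_subtractf)
    ultimately have "N f i l - (if i = i' then 1 else 0) = 0"
      using mem_span_prefix[OF w, of i'] that(2,3) by simp
    then show "N f i l = (if i = i' then 1 else 0)" by simp
  qed
  define B where "B = mat p q (\<lambda>(i, l). M $$ (i, l))"
  define X where "X = mat p b (\<lambda>(i, l). M $$ (i, q + l))"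
  define Y where "Y = mat p s (\<lambda>(i, l). M $$ (i, q + b + l))"
  define Z where "Z = mat a s (\<lambda>(i, l). M $$ (p + i, q + b + l))"
  define C where "C = mat r s (\<lambda>(i, l). M $$ (p + a + i, q + b + l))"
  have carr: "B \<in> carrier_mat p q" "X \<in> carrier_mat p b" "Y \<in> carrier_mat p s"
    "Z \<in> carrier_mat a s" "C \<in> carrier_mat r s"
    by (simp_all add: B_def X_def Y_def Z_def C_def)
  have block: "block_form B X Y Z C = M"
  proof (rule eq_matI)
    fix i l assume "i < dim_row M" "l < dim_col M"
    then have il: "i < p + a + r" "l < q + b + s" using M_carr m n by auto
    show "block_form B X Y Z C $$ (i, l) = M $$ (i, l)"
      unfolding block_form_index[OF carr il] using il zero[of i l]
      by (auto simp: B_def X_def Y_def Z_def C_def m)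
  qed (use block_form_carrier[OF carr] M_carr m n in auto)
  have B_aci: "aci_mat k B"
    by (rule aci_matI[of _ I]) (simp_all add: B_def M_aff I_sub I_disj m n)
  have C_aci: "aci_mat k C"
    by (rule aci_matI[of _ "\<lambda>l. I (q + b + l)"]) (simp_all add: C_def M_aff I_sub I_disj m n)
  have "inverts_mat T P" "inverts_mat P T" using T P TP PT by (auto simp: inverts_mat_def)
  then have "invertible_mat T" using T unfolding invertible_mat_def by auto
  moreover have "permutation_mat n Q" unfolding permutation_mat_def Q_def using \<sigma> by blast
  ultimately have equiv: "aci_equiv A M" unfolding aci_equiv_def using A(1) T M_def by auto
  have yB: "y f l = (\<Sum>i<p. fscale (N f i l) (w i))" if "l < q" for f l
  proof -
    have "y f l = (\<Sum>i<m. fscale (N f i l) (w i))" using y that n by simp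
    also have "\<dots> = (\<Sum>i<p. fscale (N f i l) (w i))"
      using that zero by (intro sum.mono_neutral_right) (auto simp: m N_def)
    finally show ?thesis .
  qed
  have B_crit: "upper_triangular_const_diag B \<or> minimal_full_rank B"
  proof (cases "q = p")
    case True
    then have "M $$ (i, l) = const_poly (if i = l then 1 else 0)" if "l \<le> i" "i < p" for i l
      using Bcase that n m by (intro tri) auto
    then have "upper_triangular_const_diag B"
      using True unfolding upper_triangular_const_diag_def B_def by (auto intro: exI[of _ 1])
    then show ?thesis ..
  next
    case False
    then have pq: "p < q" and del: "\<forall>l<q. \<exists>z. tr z \<and> \<not> w ` {..<p} \<subseteq> fun_vs.span (z ` \<tau> ` ({..<q} - {l}))"
      using Bcase by auto
    have "vec_space.rank p (completion f B) = p" for f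
    proof (rule iffD2[OF full_row_rank_iff[OF _ wp, of _ q "y f"]])
      show "completion f B \<in> carrier_mat p q" by (simp add: completion_def B_def)
      show "y f l = (\<Sum>i<p. fscale (completion f B $$ (i, l)) (w i))" if "l < q" for l
        using yB[OF that] that by (simp add: completion_def B_def N_def)
      show "w ` {..<p} \<subseteq> fun_vs.span (y f ` {..<q})"
        using Wspan trx[of f] by (simp add: y_def image_image)
    qed
    moreover have "\<not> constant_rank (delete_col B j) p" if j: "j < q" for j
    proof -
      obtain z where z: "tr z" "\<not> w ` {..<p} \<subseteq> fun_vs.span (z ` \<tau> ` ({..<q} - {j}))" using del j by blast
      obtain f where f: "\<forall>l<n. z l = x f l" using tr_ex[OF z(1)] by blast
      define h where "h l = (if l < j then l else Suc l)" for l
      have hq: "h ` {..<q - 1} = {..<q} - {j}" unfolding h_def by (rule image_skip[OF j])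
      have hl: "h l < q" if "l < q - 1" for l using hq that by blast
      have "z ` \<tau> ` ({..<q} - {j}) = (\<lambda>l. y f (h l)) ` {..<q - 1}"
      proof -
        have "z (\<tau> l) = y f l" if "l < q" for l using f \<tau>n that n by (simp add: y_def)
        then show ?thesis unfolding hq[symmetric] image_image using hl by (intro image_cong) auto
      qed
      moreover have "vec_space.rank p (completion f (delete_col B j)) = p \<longleftrightarrow>
        w ` {..<p} \<subseteq> fun_vs.span ((\<lambda>l. y f (h l)) ` {..<q - 1})"
      proof (rule full_row_rank_iff[OF _ wp])
        show "completion f (delete_col B j) \<in> carrier_mat p (q - 1)"
          by (simp add: completion_def delete_col_def B_def)
        show "y f (h l) = (\<Sum>i<p. fscale (completion f (delete_col B j) $$ (i, l)) (w i))" if "l < q - 1" for l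
          using yB[OF hl[OF that]] hl[OF that] that by (simp add: completion_def delete_col_def B_def N_def h_def)
      qed
      moreover have "dim_row (delete_col B j) = p" by (simp add: delete_col_def B_def)
      ultimately show ?thesis using z(2) unfolding constant_rank_def by auto
    qed
    ultimately show ?thesis
      using pq carr(1) unfolding minimal_full_rank_def constant_rank_def by auto
  qed
  have C_crit: "upper_triangular_const_diag C \<or> maximal_full_rank C"
  proof (cases "r = s")
    case True
    then have "M $$ (p + a + i, q + b + l) = const_poly (if p + a + i = p + a + l then 1 else 0)"
      if "l \<le> i" "i < s" for i l
      using Ccase that n m by (intro tri) auto
    then have "upper_triangular_const_diag C"
      using True unfolding upper_triangular_const_diag_def C_def by (auto intro: exI[of _ 1])
    then show ?thesis ..
  next
    case False
    then have sr: "s < r" and max: "\<forall>v\<in>fun_vs.span (e ` {..<m}). v \<notin> fun_vs.span (w ` {..<p + a}) \<longrightarrow>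
       (\<exists>z. tr z \<and> \<not> fun_vs.indep_over (insert v (w ` {..<p + a})) (\<lambda>l. z (\<tau> (q + b + l))) {..<s})"
      using Ccase by auto
    have "vec_space.rank r (completion f C) = s" for f
    proof (rule iffD2[OF full_column_rank_iff[OF _ m w, of _ s "\<lambda>l. y f (q + b + l)" "\<lambda>i l. N f i (q + b + l)"]])
      show "fun_vs.indep_over (w ` {..<p + a}) (\<lambda>l. y f (q + b + l)) {..<s}"
        unfolding y_def using Cind trx[of f] by blast
    qed (use y n in \<open>auto simp: completion_def C_def N_def\<close>)
    moreover have "\<not> constant_rank (append_const_col C v) (s + 1)" if v: "v \<in> carrier_vec r" for v
    proof
      assume cr: "constant_rank (append_const_col C v) (s + 1)"
      \<comment> \<open>The column v to be appended to C is lifted to a vector u of the whole space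
        by giving it coordinate zero on the first \<open>p + a\<close> basis vectors; the lift does
        not matter modulo U.\<close>
      define v' where "v' i = (if i < p + a then 0 else v $ (i - (p + a)))" for i
      define u where "u = (\<Sum>i<m. fscale (v' i) (w i))"
      define U where "U = w ` {..<p + a}"
      have fsU: "fun_vs.fin_spanned U" unfolding U_def by (rule fun_vs.fin_spanned_finite) simp
      have ind: "fun_vs.dim (insert u U \<union> (\<lambda>l. y f (q + b + l)) ` {..<s}) = fun_vs.dim U + (s + 1)" for f
      proof -
        \<comment> \<open>The lifted vector comes last, at index s, matching the position of the
          appended column.\<close>
        define g where "g l = (if l < s then y f (q + b + l) else u)" for l
        have "vec_space.rank r (completion f (append_const_col C v)) = s + 1 \<longleftrightarrow>
          fun_vs.indep_over U g {..<s + 1}"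
          unfolding U_def
        proof (rule full_column_rank_iff[OF _ m w])
          show "completion f (append_const_col C v) \<in> carrier_mat r (s + 1)"
            by (simp add: completion_def append_const_col_def C_def)
          show "g l = (\<Sum>i<m. fscale (if l < s then N f i (q + b + l) else v' i) (w i))" if "l < s + 1" for l
            using y[of "q + b + l" f] n that by (simp add: g_def u_def)
          show "(if l < s then N f (p + a + i) (q + b + l) else v' (p + a + i)) =
              completion f (append_const_col C v) $$ (i, l)" if "i < r" "l < s + 1" for i l
            using that by (simp add: completion_def append_const_col_def C_def N_def v'_def)
        qed
        moreover have "vec_space.rank r (completion f (append_const_col C v)) = s + 1"
          using cr unfolding constant_rank_def by (simp add: append_const_col_def C_def)
        ultimately have "fun_vs.dim (U \<union> g ` {..<s + 1}) = fun_vs.dim U + (s + 1)"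
          using fun_vs.indep_over_iff_dim[OF fsU, of "{..<s + 1}" g] by simp
        moreover have "g ` {..<s + 1} = insert u ((\<lambda>l. y f (q + b + l)) ` {..<s})"
          by (auto simp: g_def image_iff less_Suc_eq)
        ultimately show ?thesis by simp
      qed
      have fsu: "fun_vs.fin_spanned (insert u U)" by (rule fun_vs.fin_spanned_insert[OF fsU])
      \<comment> \<open>The s columns of C add at most s dimensions to \<open>insert u U\<close>, so
        u itself must add one; hence u lies outside the span of U, and the maximality of U applies
        to it.\<close>
      have dimu: "fun_vs.dim (insert u U) = fun_vs.dim U + 1"
        using ind[of "\<lambda>_. 0"] fun_vs.fin_dim_Un_image[OF fsu, of "{..<s}" "\<lambda>l. y (\<lambda>_. 0) (q + b + l)"]
          fun_vs.fin_dim_insert[OF fsU, of u] by (auto split: if_splits)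
      then have "u \<notin> fun_vs.span U" using fun_vs.fin_dim_insert[OF fsU, of u] by auto
      moreover have "u \<in> fun_vs.span (e ` {..<m})"
        unfolding spanw[symmetric] u_def
        by (intro fun_vs.span_sum fun_vs.span_scale fun_vs.span_base imageI)
      ultimately obtain z where z: "tr z" "\<not> fun_vs.indep_over (insert u U) (\<lambda>l. z (\<tau> (q + b + l))) {..<s}"
        using max unfolding U_def by blast
      obtain f where f: "\<forall>l<n. z l = x f l" using tr_ex[OF z(1)] by blast
      have "\<not> fun_vs.indep_over (insert u U) (\<lambda>l. y f (q + b + l)) {..<s}"
        using z(2) f \<tau>n n
        by (subst fun_vs.indep_over_cong[where y = "\<lambda>l. z (\<tau> (q + b + l))" and U' = "insert u U"])
          (auto simp: y_def)
      then show False
        using ind[of f] dimu fun_vs.indep_over_iff_dim[OF fsu, of "{..<s}" "\<lambda>l. y f (q + b + l)"] by simp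
    qed
    ultimately show ?thesis
      using sr carr(5) unfolding maximal_full_rank_def constant_rank_def by auto
  qed
  show ?thesis
    using carr B_aci C_aci M_aci equiv B_crit C_crit \<rho> unfolding block[symmetric] by blast
qed

theorem theorem2p5:
  fixes A :: "'a::field mpoly mat" and k m n \<rho> :: nat
  assumes "A \<in> carrier_mat m n"
    and "aci_mat k A"
    and "\<rho> \<le> min m n"
  shows "constant_rank A \<rho> \<longleftrightarrow>
    (\<exists>p q r s a b B X Y Z C.
       B \<in> carrier_mat p q \<and> X \<in> carrier_mat p b \<and> Y \<in> carrier_mat p s \<and>
       Z \<in> carrier_mat a s \<and> C \<in> carrier_mat r s \<and>
       aci_mat k B \<and> aci_mat k C \<and> aci_mat k (block_form B X Y Z C) \<and>
       aci_equiv A (block_form B X Y Z C) \<and>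
       (upper_triangular_const_diag B \<or> minimal_full_rank B) \<and>
       (upper_triangular_const_diag C \<or> maximal_full_rank C) \<and>
       p + s = \<rho>)" (is "_ \<longleftrightarrow> ?R")
proof
  assume "constant_rank A \<rho>"
  then show ?R by (rule constant_rank_block_form[OF assms(1,2)])
next
  assume ?R
  then obtain p q r s a b B X Y Z C where
    carr: "B \<in> carrier_mat p q" "X \<in> carrier_mat p b" "Y \<in> carrier_mat p s"
      "Z \<in> carrier_mat a s" "C \<in> carrier_mat r s"
    and eq: "aci_equiv A (block_form B X Y Z C)"
    and B: "upper_triangular_const_diag B \<or> minimal_full_rank B"
    and C: "upper_triangular_const_diag C \<or> maximal_full_rank C"
    and \<rho>: "p + s = \<rho>" by blast
  have "constant_rank B p"
    using B upper_triangular_const_diag_rank[of B] carr(1) unfolding minimal_full_rank_def by auto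
  \<comment> \<open>In the triangular case the rank is the number r of rows, which equals s because
    C is square.\<close>
  moreover have "constant_rank C s"
    using C upper_triangular_const_diag_rank[of C] carr(5)
    unfolding maximal_full_rank_def upper_triangular_const_diag_def by auto
  ultimately show "constant_rank A \<rho>"
    using block_form_constant_rank[OF assms(1) carr eq] \<rho> by simp
qed

end
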